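(* The category $\mathrm{DVect}$ has enough projectives; that is, for any diffeological vector space $V$ there exists a projective diffeological vector space $P(V)$ together with a linear subduction $P(V)\to V$.
   Context: A diffeological space is a set $X$ together with a specified set of functions $U\to X$ (called plots), for every open set $U\subseteq\mathbb{R}^n$ and every $n\in\mathbb{N}=\{0,1,2,\dots\}$, such that: (1) every constant map $U\to X$ is a plot; (2) if $U\to X$ is a plot and $V\to U$ is a smooth map between open subsets of Euclidean spaces, then $V\to U\to X$ is a plot; (3) if $U=\bigcup_i U_i$ is an open cover and $U\to X$ is a map whose restrictions to all $U_i$ are plots, then $U\to X$ is a plot. A map between diffeological spaces is smooth if composing with it sends plots to plots. Products carry the product diffeology (a map into a product is a plot iff all its components are plots), and $\mathbb{R}$ carries the standard diffeology. A diffeological vector space is a real vector space $V$ with a diffeology such that addition $V\times V\to V$ and scalar multiplication $\mathbb{R}\times V\to V$ are smooth. $\mathrm{DVect}$ is the category of diffeological vector spaces and smooth linear maps. A linear subduction is a smooth linear surjection $f:W_1\to W_2$ of diffeological vector spaces such that every plot of $W_2$ locally (near each point of its domain) lifts along $f$ to a plot of $W_1$. A diffeological vector space $V$ is projective if for every linear subduction $f:W_1\to W_2$ and every smooth linear map $g:V\to W_2$ there exists a smooth linear map $h:V\to W_1$ with $g=f\circ h$. *)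

theory Defs
  imports "HOL-Analysis.Abstract_Euclidean_Space" "HOL-Algebra.Module"
begin

section \<open>Smooth maps between open subsets of Euclidean spaces\<close>

text \<open>
  The dimension of the domain of a plot varies inside a single diffeology, so Euclidean
  \<open>n\<close>-space is taken to be \<^const>\<open>Euclidean_space\<close> \<open>n\<close>, whose points are the sequences
  \<open>x\<close> with \<open>x i = 0\<close> for all \<open>i \<ge> n\<close>.
\<close>

type_synonym point = "nat \<Rightarrow> real"

text \<open>
  \<open>cont_diff k n U f\<close>: all iterated partial derivatives of \<open>f\<close> of order at most \<open>k\<close>
  exist and are continuous on the open set \<open>U\<close>.  As \<open>U\<close> is open, the values of \<open>f\<close>
  outside \<open>U\<close> are irrelevant.
\<close>

primrec cont_diff :: "nat \<Rightarrow> nat \<Rightarrow> point set \<Rightarrow> (point \<Rightarrow> real) \<Rightarrow> bool" where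
  "cont_diff 0 n U f \<longleftrightarrow> continuous_map (subtopology (Euclidean_space n) U) euclideanreal f"
| "cont_diff (Suc k) n U f \<longleftrightarrow>
     continuous_map (subtopology (Euclidean_space n) U) euclideanreal f \<and>
     (\<exists>g. \<forall>i<n. (\<forall>x\<in>U. ((\<lambda>t. f (x(i := t))) has_real_derivative g i x) (at (x i))) \<and>
                cont_diff k n U (g i))"

definition smooth_real :: "nat \<Rightarrow> point set \<Rightarrow> (point \<Rightarrow> real) \<Rightarrow> bool" where
  "smooth_real n U f \<longleftrightarrow> (\<forall>k. cont_diff k n U f)"

definition smooth_euclidean ::
    "nat \<Rightarrow> point set \<Rightarrow> nat \<Rightarrow> point set \<Rightarrow> (point \<Rightarrow> point) \<Rightarrow> bool" where
  "smooth_euclidean m V n U f \<longleftrightarrow>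
     openin (Euclidean_space m) V \<and> openin (Euclidean_space n) U \<and>
     f \<in> V \<rightarrow> U \<and> (\<forall>i<n. smooth_real m V (\<lambda>x. f x i))"


section \<open>Diffeological spaces\<close>

text \<open>
  \<open>D n U p\<close> says that \<open>p\<close>, restricted to the open subset \<open>U\<close> of Euclidean \<open>n\<close>-space, is a plot.
  Since functions in HOL are total, a function on \<open>U\<close> is represented by any of its extensions;
  \<open>plot_cong\<close> says that being a plot depends on the values on \<open>U\<close> only.
\<close>

type_synonym 'a diffeology = "nat \<Rightarrow> point set \<Rightarrow> (point \<Rightarrow> 'a) \<Rightarrow> bool"

locale diffeological_space =
  fixes X :: "'a set" and D :: "'a diffeology"
  assumes plot_open: "D n U p \<Longrightarrow> openin (Euclidean_space n) U"
    and plot_range: "D n U p \<Longrightarrow> p \<in> U \<rightarrow> X"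
    and plot_cong: "D n U p \<Longrightarrow> (\<And>x. x \<in> U \<Longrightarrow> p x = q x) \<Longrightarrow> D n U q"
    and plot_const: "openin (Euclidean_space n) U \<Longrightarrow> c \<in> X \<Longrightarrow> D n U (\<lambda>_. c)"
    and plot_compose: "D n U p \<Longrightarrow> smooth_euclidean m V n U f \<Longrightarrow> D m V (p \<circ> f)"
    and plot_local: "(\<And>U. U \<in> \<U> \<Longrightarrow> openin (Euclidean_space n) U) \<Longrightarrow> p \<in> \<Union>\<U> \<rightarrow> X \<Longrightarrow>
                     (\<And>U. U \<in> \<U> \<Longrightarrow> D n U p) \<Longrightarrow> D n (\<Union>\<U>) p"

definition smooth_map ::
    "'a set \<Rightarrow> 'a diffeology \<Rightarrow> 'b set \<Rightarrow> 'b diffeology \<Rightarrow> ('a \<Rightarrow> 'b) \<Rightarrow> bool" where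
  "smooth_map X D Y E f \<longleftrightarrow> f \<in> X \<rightarrow> Y \<and> (\<forall>n U p. D n U p \<longrightarrow> E n U (f \<circ> p))"

definition prod_diffeology :: "'a diffeology \<Rightarrow> 'b diffeology \<Rightarrow> ('a \<times> 'b) diffeology" where
  "prod_diffeology D E n U p \<longleftrightarrow> D n U (fst \<circ> p) \<and> E n U (snd \<circ> p)"

definition real_diffeology :: "real diffeology" where
  "real_diffeology n U p \<longleftrightarrow> openin (Euclidean_space n) U \<and> smooth_real n U p"


section \<open>Diffeological vector spaces\<close>

definition real_ring :: "real ring" where
  "real_ring = \<lparr>carrier = UNIV, mult = (*), one = 1, zero = 0, add = (+)\<rparr>"

text \<open>
  Real vector spaces with an explicit carrier are the library's modules over \<^const>\<open>real_ring\<close>.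
  The library's record of modules also has the fields \<open>mult\<close> and \<open>one\<close>, which play no role here.
\<close>

record 'a dvs = "(real, 'a) module" +
  plot :: "'a diffeology"

locale diff_vector_space =
  Module.module real_ring V + diffeological_space "carrier V" "plot V"
  for V :: "'a dvs" (structure) +
  assumes add_smooth:
      "smooth_map (carrier V \<times> carrier V) (prod_diffeology (plot V) (plot V))
                  (carrier V) (plot V) (\<lambda>(x, y). x \<oplus> y)"
    and smult_smooth:
      "smooth_map (UNIV \<times> carrier V) (prod_diffeology real_diffeology (plot V))
                  (carrier V) (plot V) (\<lambda>(r, x). r \<odot> x)"

definition linear_map :: "'a dvs \<Rightarrow> 'b dvs \<Rightarrow> ('a \<Rightarrow> 'b) \<Rightarrow> bool" where
  "linear_map V W f \<longleftrightarrow> f \<in> carrier V \<rightarrow> carrier W \<and>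
     (\<forall>x\<in>carrier V. \<forall>y\<in>carrier V. f (x \<oplus>\<^bsub>V\<^esub> y) = f x \<oplus>\<^bsub>W\<^esub> f y) \<and>
     (\<forall>r. \<forall>x\<in>carrier V. f (r \<odot>\<^bsub>V\<^esub> x) = r \<odot>\<^bsub>W\<^esub> f x)"

definition smooth_linear :: "'a dvs \<Rightarrow> 'b dvs \<Rightarrow> ('a \<Rightarrow> 'b) \<Rightarrow> bool" where
  "smooth_linear V W f \<longleftrightarrow>
     linear_map V W f \<and> smooth_map (carrier V) (plot V) (carrier W) (plot W) f"

definition linear_subduction :: "'a dvs \<Rightarrow> 'b dvs \<Rightarrow> ('a \<Rightarrow> 'b) \<Rightarrow> bool" where
  "linear_subduction W1 W2 f \<longleftrightarrow>
     smooth_linear W1 W2 f \<and> f ` carrier W1 = carrier W2 \<and>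
     (\<forall>n U p. plot W2 n U p \<longrightarrow>
        (\<forall>x\<in>U. \<exists>U' q. openin (Euclidean_space n) U' \<and> x \<in> U' \<and> U' \<subseteq> U \<and>
                       plot W1 n U' q \<and> (\<forall>y\<in>U'. f (q y) = p y)))"


section \<open>Projective diffeological vector spaces\<close>

text \<open>
  \<open>'a formal\<close> is a type in which formal real linear combinations of pairs (parametrization
  in \<open>'a\<close>, point) live.  It serves as the universe for the test objects of projectivity of a
  diffeological vector space \<open>P\<close> with carrier in \<open>'a\<close>: HOL cannot quantify over all types
  inside a formula, so \<open>projective\<close> lets \<open>W1\<close> and \<open>W2\<close> range over all diffeological vector
  spaces with carrier in \<open>'a formal\<close>.  This is no restriction: by \<open>projective_lift\<close> below, such
  a \<open>P\<close> has the lifting property for linear subductions between diffeological vector spaces with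
  carriers in arbitrary types.
\<close>

type_synonym 'a formal = "(nat \<times> point set \<times> (point \<Rightarrow> 'a)) \<times> point \<Rightarrow> real"

definition projective :: "'a dvs \<Rightarrow> bool" where
  "projective P \<longleftrightarrow> diff_vector_space P \<and>
     (\<forall>(W1 :: 'a formal dvs) (W2 :: 'a formal dvs) f g.
        diff_vector_space W1 \<longrightarrow> diff_vector_space W2 \<longrightarrow>
        linear_subduction W1 W2 f \<longrightarrow> smooth_linear P W2 g \<longrightarrow>
        (\<exists>h. smooth_linear P W1 h \<and> (\<forall>x\<in>carrier P. g x = f (h x))))"


subsection \<open>Independence of the universe\<close>

lemma cont_diff_const: "cont_diff k n U (\<lambda>_. c)"
proof (induction k arbitrary: c)
  case 0
  then show ?case by simp
next
  case (Suc k)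
  have "\<forall>i<n. (\<forall>x\<in>U. ((\<lambda>t. c) has_real_derivative (\<lambda>_ _. 0) i x) (at (x i))) \<and>
              cont_diff k n U ((\<lambda>_ _. 0) i)"
    using Suc by auto
  then show ?case by (simp only: cont_diff.simps) (intro conjI exI, auto)
qed

lemma cont_diff_proj: "cont_diff k n U (\<lambda>x. x j)"
proof -
  have c: "continuous_map (subtopology (Euclidean_space n) U) euclideanreal (\<lambda>x. x j)"
    unfolding Euclidean_space_def
    by (intro continuous_map_from_subtopology continuous_map_product_projection) simp
  show ?thesis
  proof (cases k)
    case 0
    then show ?thesis using c by simp
  next
    case (Suc k')
    define g where "g = (\<lambda>i (x::point). if i = j then 1 else (0::real))"
    have "((\<lambda>t. (x(i := t)) j) has_real_derivative g i x) (at (x i))" for i and x :: point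
      by (cases "i = j") (auto simp: g_def)
    moreover have "cont_diff k' n U (g i)" for i
      unfolding g_def by (rule cont_diff_const)
    ultimately show ?thesis using c Suc by (simp only: cont_diff.simps) blast
  qed
qed

lemma smooth_inclusion:
  assumes "openin (Euclidean_space n) U" "openin (Euclidean_space n) V" "V \<subseteq> U"
  shows "smooth_euclidean n V n U (\<lambda>x. x)"
  using assms cont_diff_proj unfolding smooth_euclidean_def smooth_real_def by auto

lemma cring_real_ring: "cring real_ring"
proof (rule cringI)
  show "abelian_group real_ring"
  proof (rule abelian_groupI)
    fix x :: real
    show "\<exists>y\<in>carrier real_ring. y \<oplus>\<^bsub>real_ring\<^esub> x = \<zero>\<^bsub>real_ring\<^esub>"
      by (rule bexI[of _ "- x"]) (auto simp: real_ring_def)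
  qed (auto simp: real_ring_def)
  show "Group.comm_monoid real_ring"
    by (rule comm_monoidI) (auto simp: real_ring_def)
qed (auto simp: real_ring_def algebra_simps)

lemma real_ring_simps [simp]:
  "carrier real_ring = UNIV" "mult real_ring = (*)" "one real_ring = 1"
  "zero real_ring = 0" "add real_ring = (+)"
  by (auto simp: real_ring_def)

context diff_vector_space
begin

lemma plot_restrict:
  assumes "plot V n U p" "openin (Euclidean_space n) U'" "U' \<subseteq> U"
  shows "plot V n U' p"
  using plot_compose[OF assms(1) smooth_inclusion[OF plot_open[OF assms(1)] assms(2,3)]]
  by (simp add: comp_def)

lemma plot_in: "plot V n U p \<Longrightarrow> x \<in> U \<Longrightarrow> p x \<in> carrier V"
  using plot_range by blast

lemma plot_add:
  assumes "plot V n U p" "plot V n U q"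
  shows "plot V n U (\<lambda>x. p x \<oplus> q x)"
proof -
  have "prod_diffeology (plot V) (plot V) n U (\<lambda>x. (p x, q x))"
    using assms by (simp add: prod_diffeology_def comp_def)
  then have "plot V n U ((\<lambda>(x, y). x \<oplus> y) \<circ> (\<lambda>x. (p x, q x)))"
    using add_smooth unfolding smooth_map_def by blast
  then show ?thesis by (simp add: comp_def)
qed

lemma plot_smult:
  assumes "real_diffeology n U r" "plot V n U q"
  shows "plot V n U (\<lambda>x. r x \<odot> q x)"
proof -
  have "prod_diffeology real_diffeology (plot V) n U (\<lambda>x. (r x, q x))"
    using assms by (simp add: prod_diffeology_def comp_def)
  then have "plot V n U ((\<lambda>(r, x). r \<odot> x) \<circ> (\<lambda>x. (r x, q x)))"
    using smult_smooth unfolding smooth_map_def by blast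
  then show ?thesis by (simp add: comp_def)
qed

end

lemma diff_vector_spaceI:
  fixes M :: "'a dvs"
  assumes "Module.module real_ring M" "diffeological_space (carrier M) (plot M)"
    and add: "\<And>n U p q. plot M n U p \<Longrightarrow> plot M n U q \<Longrightarrow> plot M n U (\<lambda>x. p x \<oplus>\<^bsub>M\<^esub> q x)"
    and smult: "\<And>n U r q. real_diffeology n U r \<Longrightarrow> plot M n U q \<Longrightarrow>
                  plot M n U (\<lambda>x. r x \<odot>\<^bsub>M\<^esub> q x)"
  shows "diff_vector_space M"
proof -
  interpret Module.module real_ring M by fact
  show ?thesis
  proof (intro diff_vector_space.intro diff_vector_space_axioms.intro assms(1,2))
    show "smooth_map (carrier M \<times> carrier M) (prod_diffeology (plot M) (plot M))
                  (carrier M) (plot M) (\<lambda>(x, y). x \<oplus>\<^bsub>M\<^esub> y)"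
      unfolding smooth_map_def prod_diffeology_def
      using add by (auto simp: comp_def case_prod_beta)
    show "smooth_map (UNIV \<times> carrier M) (prod_diffeology real_diffeology (plot M))
                  (carrier M) (plot M) (\<lambda>(r, x). r \<odot>\<^bsub>M\<^esub> x)"
      unfolding smooth_map_def prod_diffeology_def
      using smult smult_closed by (auto simp: comp_def case_prod_beta)
  qed
qed

lemma linear_mapD:
  assumes "linear_map V W f"
  shows "x \<in> carrier V \<Longrightarrow> f x \<in> carrier W"
    and "x \<in> carrier V \<Longrightarrow> y \<in> carrier V \<Longrightarrow> f (x \<oplus>\<^bsub>V\<^esub> y) = f x \<oplus>\<^bsub>W\<^esub> f y"
    and "x \<in> carrier V \<Longrightarrow> f (r \<odot>\<^bsub>V\<^esub> x) = r \<odot>\<^bsub>W\<^esub> f x"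
  using assms unfolding linear_map_def by auto

lemma linear_subductionD:
  assumes "linear_subduction W1 W2 f" "plot W2 n U p" "x \<in> U"
  shows "\<exists>U' q. openin (Euclidean_space n) U' \<and> x \<in> U' \<and> U' \<subseteq> U \<and>
                plot W1 n U' q \<and> (\<forall>y\<in>U'. f (q y) = p y)"
  using assms unfolding linear_subduction_def by blast

lemma smooth_linear_comp:
  assumes "smooth_linear U V f" "smooth_linear V W g"
  shows "smooth_linear U W (g \<circ> f)"
  using assms unfolding smooth_linear_def linear_map_def smooth_map_def
  by (auto simp: Pi_iff comp_assoc)

definition initial_plot ::
    "'m dvs \<Rightarrow> 'a dvs \<Rightarrow> ('m \<Rightarrow> 'a) \<Rightarrow> 'b dvs \<Rightarrow> ('m \<Rightarrow> 'b) \<Rightarrow> 'm diffeology" where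
  "initial_plot M V \<phi> W \<psi> n U c \<longleftrightarrow>
     c \<in> U \<rightarrow> carrier M \<and> plot V n U (\<phi> \<circ> c) \<and> plot W n U (\<psi> \<circ> c)"

lemma diff_vector_space_initial:
  fixes M :: "'m dvs"
  assumes M: "Module.module real_ring M"
    and V: "diff_vector_space V" and W: "diff_vector_space W"
    and \<phi>: "linear_map M V \<phi>" and \<psi>: "linear_map M W \<psi>"
    and pl: "plot M = initial_plot M V \<phi> W \<psi>"
  shows "diff_vector_space M"
proof -
  interpret M: Module.module real_ring M by fact
  interpret V: diff_vector_space V by fact
  interpret W: diff_vector_space W by fact
  note \<phi>D = linear_mapD[OF \<phi>] and \<psi>D = linear_mapD[OF \<psi>]
  show ?thesis
  proof (rule diff_vector_spaceI[OF M])
    show "diffeological_space (carrier M) (plot M)"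
    proof (unfold pl, unfold_locales)
      fix n U p assume "initial_plot M V \<phi> W \<psi> n U p"
      then show "openin (Euclidean_space n) U" "p \<in> U \<rightarrow> carrier M"
        using V.plot_open unfolding initial_plot_def by auto
    next
      fix n U p q assume p: "initial_plot M V \<phi> W \<psi> n U p" and e: "\<And>x. x \<in> U \<Longrightarrow> p x = q x"
      show "initial_plot M V \<phi> W \<psi> n U q"
        unfolding initial_plot_def
      proof (intro conjI)
        show "q \<in> U \<rightarrow> carrier M"
          using p e unfolding initial_plot_def Pi_iff by metis
        show "plot V n U (\<phi> \<circ> q)"
          by (rule V.plot_cong[of _ _ "\<phi> \<circ> p"]) (use p e in \<open>auto simp: initial_plot_def\<close>)
        show "plot W n U (\<psi> \<circ> q)"
          by (rule W.plot_cong[of _ _ "\<psi> \<circ> p"]) (use p e in \<open>auto simp: initial_plot_def\<close>)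
      qed
    next
      fix n U c assume "openin (Euclidean_space n) U" "c \<in> carrier M"
      then show "initial_plot M V \<phi> W \<psi> n U (\<lambda>_. c)"
        using V.plot_const W.plot_const \<phi>D \<psi>D unfolding initial_plot_def by (auto simp: comp_def)
    next
      fix n U p m U' f
      assume p: "initial_plot M V \<phi> W \<psi> n U p" and f: "smooth_euclidean m U' n U f"
      have "f \<in> U' \<rightarrow> U" using f unfolding smooth_euclidean_def by auto
      then show "initial_plot M V \<phi> W \<psi> m U' (p \<circ> f)"
        using p V.plot_compose[OF _ f, of "\<phi> \<circ> p"] W.plot_compose[OF _ f, of "\<psi> \<circ> p"]
        unfolding initial_plot_def by (auto simp: comp_assoc)
    next
      fix \<U> n p
      assume o: "\<And>U. U \<in> \<U> \<Longrightarrow> openin (Euclidean_space n) U" and p: "p \<in> \<Union>\<U> \<rightarrow> carrier M"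
        and l: "\<And>U. U \<in> \<U> \<Longrightarrow> initial_plot M V \<phi> W \<psi> n U p"
      have r: "\<phi> (p x) \<in> carrier V" "\<psi> (p x) \<in> carrier W" if "x \<in> \<Union>\<U>" for x
        using \<phi>D(1) \<psi>D(1) funcset_mem[OF p that] by auto
      show "initial_plot M V \<phi> W \<psi> n (\<Union>\<U>) p"
        unfolding initial_plot_def
      proof (intro conjI p)
        show "plot V n (\<Union>\<U>) (\<phi> \<circ> p)"
          by (rule V.plot_local) (use o l r in \<open>auto simp: initial_plot_def\<close>)
        show "plot W n (\<Union>\<U>) (\<psi> \<circ> p)"
          by (rule W.plot_local) (use o l r in \<open>auto simp: initial_plot_def\<close>)
      qed
    qed
  next
    fix n U p q assume p: "plot M n U p" and q: "plot M n U q"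
    have pq: "p x \<in> carrier M" "q x \<in> carrier M" if "x \<in> U" for x
      using p q that unfolding pl initial_plot_def by auto
    show "plot M n U (\<lambda>x. p x \<oplus>\<^bsub>M\<^esub> q x)"
      unfolding pl initial_plot_def
    proof (intro conjI)
      show "(\<lambda>x. p x \<oplus>\<^bsub>M\<^esub> q x) \<in> U \<rightarrow> carrier M" using pq by auto
      have "plot V n U (\<lambda>x. (\<phi> \<circ> p) x \<oplus>\<^bsub>V\<^esub> (\<phi> \<circ> q) x)"
        using p q unfolding pl initial_plot_def by (intro V.plot_add) (auto simp: comp_def)
      then show "plot V n U (\<phi> \<circ> (\<lambda>x. p x \<oplus>\<^bsub>M\<^esub> q x))"
        by (rule V.plot_cong) (simp add: pq \<phi>D)
      have "plot W n U (\<lambda>x. (\<psi> \<circ> p) x \<oplus>\<^bsub>W\<^esub> (\<psi> \<circ> q) x)"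
        using p q unfolding pl initial_plot_def by (intro W.plot_add) (auto simp: comp_def)
      then show "plot W n U (\<psi> \<circ> (\<lambda>x. p x \<oplus>\<^bsub>M\<^esub> q x))"
        by (rule W.plot_cong) (simp add: pq \<psi>D)
    qed
  next
    fix n U r q assume r: "real_diffeology n U r" and q: "plot M n U q"
    have q': "q x \<in> carrier M" if "x \<in> U" for x
      using q that unfolding pl initial_plot_def by auto
    show "plot M n U (\<lambda>x. r x \<odot>\<^bsub>M\<^esub> q x)"
      unfolding pl initial_plot_def
    proof (intro conjI)
      show "(\<lambda>x. r x \<odot>\<^bsub>M\<^esub> q x) \<in> U \<rightarrow> carrier M" using q' M.smult_closed by auto
      have "plot V n U (\<lambda>x. r x \<odot>\<^bsub>V\<^esub> (\<phi> \<circ> q) x)"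
        using q r unfolding pl initial_plot_def by (intro V.plot_smult) (auto simp: comp_def)
      then show "plot V n U (\<phi> \<circ> (\<lambda>x. r x \<odot>\<^bsub>M\<^esub> q x))"
        by (rule V.plot_cong) (simp add: q' \<phi>D)
      have "plot W n U (\<lambda>x. r x \<odot>\<^bsub>W\<^esub> (\<psi> \<circ> q) x)"
        using q r unfolding pl initial_plot_def by (intro W.plot_smult) (auto simp: comp_def)
      then show "plot W n U (\<psi> \<circ> (\<lambda>x. r x \<odot>\<^bsub>M\<^esub> q x))"
        by (rule W.plot_cong) (simp add: q' \<psi>D)
    qed
  qed
qed

definition transport :: "('a \<Rightarrow> 'b) \<Rightarrow> 'a dvs \<Rightarrow> 'b dvs" where
  "transport e V = (let d = inv_into (carrier V) e in
     \<lparr>carrier = e ` carrier V, mult = undefined, one = undefined, zero = e \<zero>\<^bsub>V\<^esub>,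
      add = (\<lambda>x y. e (d x \<oplus>\<^bsub>V\<^esub> d y)), smult = (\<lambda>r x. e (r \<odot>\<^bsub>V\<^esub> d x)),
      plot = (\<lambda>n U c. c \<in> U \<rightarrow> e ` carrier V \<and> plot V n U (d \<circ> c))\<rparr>)"

lemma transport:
  fixes V :: "'a dvs" and e :: "'a \<Rightarrow> 'b"
  assumes V: "diff_vector_space V" and e: "inj_on e (carrier V)"
  defines "d \<equiv> inv_into (carrier V) e"
  shows "diff_vector_space (transport e V)"
    and "smooth_linear V (transport e V) e"
    and "smooth_linear (transport e V) V d"
proof -
  interpret V: diff_vector_space V by fact
  let ?T = "transport e V"
  have T: "carrier ?T = e ` carrier V" "zero ?T = e \<zero>\<^bsub>V\<^esub>"
    "add ?T = (\<lambda>x y. e (d x \<oplus>\<^bsub>V\<^esub> d y))" "smult ?T = (\<lambda>r x. e (r \<odot>\<^bsub>V\<^esub> d x))"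
    by (auto simp: transport_def d_def Let_def)
  have Tp: "plot ?T = (\<lambda>n U c. c \<in> U \<rightarrow> e ` carrier V \<and> plot V n U (d \<circ> c))"
    by (auto simp: transport_def d_def Let_def)
  have de [simp]: "d (e x) = x" if "x \<in> carrier V" for x
    unfolding d_def using e that by (rule inv_into_f_f)
  have sm: "r \<odot>\<^bsub>V\<^esub> x \<in> carrier V" if "x \<in> carrier V" for r x
    using V.smult_closed that by simp
  have mod: "Module.module real_ring ?T"
  proof (rule moduleI[OF cring_real_ring])
    show "abelian_group ?T"
    proof (rule abelian_groupI)
      fix x assume "x \<in> carrier ?T"
      then obtain x' where x': "x' \<in> carrier V" "x = e x'" unfolding T by auto
      then show "\<exists>y\<in>carrier ?T. y \<oplus>\<^bsub>?T\<^esub> x = \<zero>\<^bsub>?T\<^esub>"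
        unfolding T by (intro bexI[of _ "e (\<ominus>\<^bsub>V\<^esub> x')"]) (auto simp: V.l_neg)
    qed (auto simp: T V.a_ac)
  qed (use V.smult_l_distr V.smult_r_distr V.smult_assoc1 V.smult_one in \<open>auto simp: T sm\<close>)
  have d: "linear_map ?T V d"
    unfolding linear_map_def T by (auto simp: sm)
  show "diff_vector_space ?T"
    by (rule diff_vector_space_initial[OF mod V V d d])
       (auto simp: Tp initial_plot_def T fun_eq_iff)
  show "smooth_linear ?T V d"
    using d unfolding smooth_linear_def smooth_map_def Tp linear_map_def by auto
  show "smooth_linear V ?T e"
    unfolding smooth_linear_def smooth_map_def linear_map_def
  proof (intro conjI allI impI)
    fix n U p assume p: "plot V n U p"
    have "plot V n U (d \<circ> (e \<circ> p))"
      by (rule V.plot_cong[OF p]) (use V.plot_in[OF p] in simp)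
    then show "plot ?T n U (e \<circ> p)" unfolding Tp using V.plot_in[OF p] by auto
  qed (auto simp: T sm)
qed

subsubsection \<open>Free vector spaces\<close>

definition supp :: "('i \<Rightarrow> real) \<Rightarrow> 'i set" where
  "supp c = {i. c i \<noteq> 0}"

definition free_vs :: "'i set \<Rightarrow> ('i \<Rightarrow> real) diffeology \<Rightarrow> ('i \<Rightarrow> real) dvs" where
  "free_vs I D = \<lparr>carrier = {c. finite (supp c) \<and> supp c \<subseteq> I}, mult = undefined, one = undefined,
     zero = (\<lambda>_. 0), add = (\<lambda>c c' i. c i + c' i), smult = (\<lambda>r c i. r * c i), plot = D\<rparr>"

lemma free_vs_simps:
  "carrier (free_vs I D) = {c. finite (supp c) \<and> supp c \<subseteq> I}"
  "zero (free_vs I D) = (\<lambda>_. 0)"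
  "add (free_vs I D) = (\<lambda>c c' i. c i + c' i)"
  "smult (free_vs I D) = (\<lambda>r c i. r * c i)"
  "plot (free_vs I D) = D"
  by (auto simp: free_vs_def)

lemma supp_add: "supp (\<lambda>i. c i + c' i) \<subseteq> supp c \<union> supp c'"
  and supp_smult: "supp (\<lambda>i. r * c i) \<subseteq> supp c"
  and supp_uminus: "supp (\<lambda>i. - c i) = supp c"
  and supp_zero: "supp (\<lambda>_. 0) = {}"
  by (auto simp: supp_def)

lemma free_vs_closed:
  assumes "c \<in> carrier (free_vs I D)" "c' \<in> carrier (free_vs I D)"
  shows "(\<lambda>i. c i + c' i) \<in> carrier (free_vs I D)" "(\<lambda>i. r * c i) \<in> carrier (free_vs I D)"
  using assms supp_add[of c c'] supp_smult[of r c] unfolding free_vs_simps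
  by (auto intro: finite_subset)

lemma module_free_vs: "Module.module real_ring (free_vs I D)"
proof (rule moduleI[OF cring_real_ring])
  show "abelian_group (free_vs I D)"
  proof (rule abelian_groupI)
    fix c assume "c \<in> carrier (free_vs I D)"
    then show "\<exists>c'\<in>carrier (free_vs I D). c' \<oplus>\<^bsub>free_vs I D\<^esub> c = \<zero>\<^bsub>free_vs I D\<^esub>"
      by (intro bexI[of _ "\<lambda>i. - c i"]) (auto simp: free_vs_simps supp_uminus)
  next
    fix c c' assume "c \<in> carrier (free_vs I D)" "c' \<in> carrier (free_vs I D)"
    then show "c \<oplus>\<^bsub>free_vs I D\<^esub> c' \<in> carrier (free_vs I D)"
      using free_vs_closed(1) by (simp add: free_vs_simps(3))
  qed (auto simp: free_vs_simps supp_zero algebra_simps)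
next
  fix r c assume "c \<in> carrier (free_vs I D)"
  then show "r \<odot>\<^bsub>free_vs I D\<^esub> c \<in> carrier (free_vs I D)"
    using free_vs_closed(2) by (simp add: free_vs_simps(4))
qed (auto simp: free_vs_simps algebra_simps)

definition lin_ext :: "'a dvs \<Rightarrow> ('i \<Rightarrow> 'a) \<Rightarrow> ('i \<Rightarrow> real) \<Rightarrow> 'a" where
  "lin_ext V v c = (\<Oplus>\<^bsub>V\<^esub>i\<in>supp c. c i \<odot>\<^bsub>V\<^esub> v i)"

context diff_vector_space
begin

lemma smult_in: "x \<in> carrier V \<Longrightarrow> r \<odot> x \<in> carrier V"
  using smult_closed by simp

lemma smult_zero_left: "x \<in> carrier V \<Longrightarrow> 0 \<odot> x = \<zero>"
  using smult_l_null by simp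

lemma lin_ext_superset:
  assumes v: "v \<in> I \<rightarrow> carrier V" and c: "finite A" "supp c \<subseteq> A" "A \<subseteq> I"
  shows "lin_ext V v c = (\<Oplus>i\<in>A. c i \<odot> v i)"
proof -
  have z: "c i \<odot> v i = \<zero>" if "i \<in> A - supp c" for i
  proof -
    have "v i \<in> carrier V" "c i = 0" using that v c(3) by (auto simp: supp_def)
    then show ?thesis using smult_zero_left by simp
  qed
  have "c i \<odot> v i \<in> carrier V" if "i \<in> A" for i
    using v c(3) that by (intro smult_in) auto
  then show ?thesis
    unfolding lin_ext_def using z
    by (intro add.finprod_mono_neutral_cong_left[OF c(1,2), folded finsum_def, simplified]) auto
qed

lemma linear_lin_ext:
  assumes v: "v \<in> I \<rightarrow> carrier V"
  shows "linear_map (free_vs I D) V (lin_ext V v)"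
  unfolding linear_map_def
proof (intro conjI ballI allI)
  show "lin_ext V v \<in> carrier (free_vs I D) \<rightarrow> carrier V"
    using v unfolding lin_ext_def free_vs_simps by (auto intro!: finsum_closed smult_in)
next
  fix c c' assume c: "c \<in> carrier (free_vs I D)" and c': "c' \<in> carrier (free_vs I D)"
  let ?A = "supp c \<union> supp c'"
  have A: "finite ?A" "?A \<subseteq> I" using c c' by (auto simp: free_vs_simps)
  have vA: "v i \<in> carrier V" if "i \<in> ?A" for i using v A that by auto
  have "lin_ext V v (c \<oplus>\<^bsub>free_vs I D\<^esub> c') = (\<Oplus>i\<in>?A. (c i + c' i) \<odot> v i)"
    using lin_ext_superset[OF v A(1) _ A(2), of "\<lambda>i. c i + c' i"] supp_add[of c c']
    by (simp add: free_vs_simps)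
  also have "\<dots> = (\<Oplus>i\<in>?A. c i \<odot> v i \<oplus> c' i \<odot> v i)"
    using vA smult_l_distr smult_in by (intro finsum_cong') auto
  also have "\<dots> = (\<Oplus>i\<in>?A. c i \<odot> v i) \<oplus> (\<Oplus>i\<in>?A. c' i \<odot> v i)"
    using vA smult_in by (intro finsum_addf) blast+
  also have "\<dots> = lin_ext V v c \<oplus> lin_ext V v c'"
    using lin_ext_superset[OF v A(1) _ A(2), of c] lin_ext_superset[OF v A(1) _ A(2), of c']
    by simp
  finally show "lin_ext V v (c \<oplus>\<^bsub>free_vs I D\<^esub> c') = lin_ext V v c \<oplus> lin_ext V v c'" .
next
  fix r c assume c: "c \<in> carrier (free_vs I D)"
  let ?A = "supp c"
  have A: "finite ?A" "?A \<subseteq> I" using c by (auto simp: free_vs_simps)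
  have vA: "v i \<in> carrier V" if "i \<in> ?A" for i using v A that by auto
  have "lin_ext V v (r \<odot>\<^bsub>free_vs I D\<^esub> c) = (\<Oplus>i\<in>?A. (r * c i) \<odot> v i)"
    using lin_ext_superset[OF v A(1) _ A(2), of "\<lambda>i. r * c i"] supp_smult[of r c]
    by (simp add: free_vs_simps)
  also have "\<dots> = (\<Oplus>i\<in>?A. r \<odot> (c i \<odot> v i))"
    using vA smult_assoc1 smult_in by (intro finsum_cong') auto
  also have "\<dots> = r \<odot> (\<Oplus>i\<in>?A. c i \<odot> v i)"
    using vA smult_in A(1) by (intro finsum_smult_ldistr[symmetric]) auto
  finally show "lin_ext V v (r \<odot>\<^bsub>free_vs I D\<^esub> c) = r \<odot> lin_ext V v c"
    by (simp add: lin_ext_def)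
qed

lemma lin_ext_basis:
  assumes "v i \<in> carrier V"
  shows "lin_ext V v (\<lambda>j. if j = i then 1 else 0) = v i"
proof -
  have "supp (\<lambda>j. if j = i then 1 else (0::real)) = {i}" by (auto simp: supp_def)
  then show ?thesis
    unfolding lin_ext_def using assms smult_in smult_one by (simp add: finsum_insert)
qed

end

lemma linear_map_zero:
  assumes V: "diff_vector_space V" and W: "diff_vector_space W" and f: "linear_map V W f"
  shows "f \<zero>\<^bsub>V\<^esub> = \<zero>\<^bsub>W\<^esub>"
proof -
  interpret V: diff_vector_space V by fact
  interpret W: diff_vector_space W by fact
  have "f (0 \<odot>\<^bsub>V\<^esub> \<zero>\<^bsub>V\<^esub>) = 0 \<odot>\<^bsub>W\<^esub> f \<zero>\<^bsub>V\<^esub>"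
    by (rule linear_mapD(3)[OF f]) simp
  then show ?thesis
    using linear_mapD(1)[OF f, of "\<zero>\<^bsub>V\<^esub>"] V.smult_zero_left W.smult_zero_left by simp
qed

lemma linear_map_lin_ext:
  assumes V: "diff_vector_space V" and W: "diff_vector_space W" and f: "linear_map V W f"
    and v: "v \<in> I \<rightarrow> carrier V" and c: "c \<in> carrier (free_vs I D)"
  shows "f (lin_ext V v c) = lin_ext W (f \<circ> v) c"
proof -
  interpret V: diff_vector_space V by fact
  interpret W: diff_vector_space W by fact
  note fD = linear_mapD[OF f]
  have "finite A \<Longrightarrow> A \<subseteq> I \<Longrightarrow>
      f (\<Oplus>\<^bsub>V\<^esub>i\<in>A. c i \<odot>\<^bsub>V\<^esub> v i) = (\<Oplus>\<^bsub>W\<^esub>i\<in>A. c i \<odot>\<^bsub>W\<^esub> (f \<circ> v) i)" for A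
  proof (induction A rule: finite_induct)
    case empty
    then show ?case using linear_map_zero[OF V W f] by simp
  next
    case (insert a A)
    have v': "v i \<in> carrier V" if "i \<in> insert a A" for i using v insert.prems that by auto
    have "f (\<Oplus>\<^bsub>V\<^esub>i\<in>insert a A. c i \<odot>\<^bsub>V\<^esub> v i) =
          f (c a \<odot>\<^bsub>V\<^esub> v a \<oplus>\<^bsub>V\<^esub> (\<Oplus>\<^bsub>V\<^esub>i\<in>A. c i \<odot>\<^bsub>V\<^esub> v i))"
      using insert v' V.smult_in by (subst V.finsum_insert) auto
    also have "\<dots> = c a \<odot>\<^bsub>W\<^esub> f (v a) \<oplus>\<^bsub>W\<^esub> f (\<Oplus>\<^bsub>V\<^esub>i\<in>A. c i \<odot>\<^bsub>V\<^esub> v i)"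
    proof -
      have "(\<Oplus>\<^bsub>V\<^esub>i\<in>A. c i \<odot>\<^bsub>V\<^esub> v i) \<in> carrier V"
        using v' V.smult_in by (intro V.finsum_closed) auto
      then show ?thesis using fD v' V.smult_in by auto
    qed
    also have "\<dots> = (\<Oplus>\<^bsub>W\<^esub>i\<in>insert a A. c i \<odot>\<^bsub>W\<^esub> (f \<circ> v) i)"
      using insert v' W.smult_in fD(1) by (subst W.finsum_insert) auto
    finally show ?case .
  qed
  then show ?thesis using c unfolding lin_ext_def free_vs_simps by auto
qed

theorem projective_lift:
  fixes P :: "'p dvs" and W1 :: "'a dvs" and W2 :: "'b dvs"
  assumes P: "projective P" and W1: "diff_vector_space W1" and W2: "diff_vector_space W2"
    and f: "linear_subduction W1 W2 f" and g: "smooth_linear P W2 g"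
  shows "\<exists>h. smooth_linear P W1 h \<and> (\<forall>x\<in>carrier P. g x = f (h x))"
proof -
  have Pd: "diff_vector_space P" using P unfolding projective_def by blast
  interpret P: diff_vector_space P by fact
  interpret W1: diff_vector_space W1 by fact
  interpret W2: diff_vector_space W2 by fact
  have fl: "linear_map W1 W2 f" and gl: "linear_map P W2 g"
    using f g unfolding linear_subduction_def smooth_linear_def by auto
  define lifts where "lifts = (\<lambda>(n, U, p) q. plot W1 n U q \<and> (\<forall>y\<in>U. f (q y) = g (p y)))"
  define liftable where "liftable = (\<lambda>s. \<exists>q. lifts s q)"
  define I where "I = {((n, U, p), u). plot P n U p \<and> u \<in> U \<and> liftable (n, U, p)}"
  define L where "L = (\<lambda>s. SOME q. lifts s q)"
  define a where "a = (\<lambda>(s, u). L s u)"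
  define b where "b = (\<lambda>((n :: nat, U :: point set, p :: point \<Rightarrow> 'p), u). p u)"
  define \<phi> where "\<phi> = lin_ext W1 a"
  define \<psi> where "\<psi> = lin_ext P b"
  define F0 :: "'p formal dvs" where "F0 = free_vs I undefined"
  define F where "F = free_vs I (initial_plot F0 W1 \<phi> P \<psi>)"
  have L: "lifts s (L s)" if "liftable s" for s
    using that unfolding L_def liftable_def by (rule someI_ex)
  have I: "\<exists>n U p u. i = ((n, U, p), u) \<and> u \<in> U \<and> liftable (n, U, p)" if "i \<in> I" for i
    using that by (cases i rule: prod.exhaust) (auto simp: I_def)
  have aI: "a \<in> I \<rightarrow> carrier W1"
  proof
    fix i assume "i \<in> I"
    obtain n U p u where i: "i = ((n, U, p), u)" "u \<in> U" "liftable (n, U, p)"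
      using I[OF \<open>i \<in> I\<close>] by (elim exE conjE)
    have "plot W1 n U (L (n, U, p))" using L[OF i(3)] unfolding lifts_def by simp
    then show "a i \<in> carrier W1" using W1.plot_in i(1,2) by (simp add: a_def)
  qed
  have bI: "b \<in> I \<rightarrow> carrier P"
    unfolding I_def b_def by (auto intro: P.plot_in)
  have fa: "f (a i) = g (b i)" if i_in: "i \<in> I" for i
  proof -
    obtain n U p u where i: "i = ((n, U, p), u)" "u \<in> U" "liftable (n, U, p)"
      using I[OF i_in] by (elim exE conjE)
    have "\<forall>y\<in>U. f (L (n, U, p) y) = g (p y)" using L[OF i(3)] unfolding lifts_def by simp
    then show ?thesis using i(1,2) by (simp add: a_def b_def)
  qed
  have \<phi>l: "linear_map F W1 \<phi>" unfolding F_def \<phi>_def by (rule W1.linear_lin_ext[OF aI])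
  have \<psi>l: "linear_map F P \<psi>" unfolding F_def \<psi>_def by (rule P.linear_lin_ext[OF bI])
  have pF: "plot F = initial_plot F W1 \<phi> P \<psi>"
    by (simp add: F_def free_vs_simps fun_eq_iff initial_plot_def F0_def)
  have F: "diff_vector_space F"
    by (rule diff_vector_space_initial[OF _ W1 Pd \<phi>l \<psi>l pF]) (simp add: F_def module_free_vs)
  have \<phi>s: "smooth_linear F W1 \<phi>" and \<psi>s: "smooth_linear F P \<psi>"
    using \<phi>l \<psi>l unfolding smooth_linear_def smooth_map_def linear_map_def pF initial_plot_def
    by auto
  have f\<phi>: "f (\<phi> c) = g (\<psi> c)" if c: "c \<in> carrier F" for c
  proof -
    have cI: "supp c \<subseteq> I" using c by (simp add: F_def free_vs_simps)
    have "f (\<phi> c) = lin_ext W2 (f \<circ> a) c"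
      unfolding \<phi>_def using linear_map_lin_ext[OF W1 W2 fl aI] c unfolding F_def by blast
    also have "\<dots> = lin_ext W2 (g \<circ> b) c"
      unfolding lin_ext_def
    proof (rule W2.finsum_cong')
      show "(\<lambda>i. c i \<odot>\<^bsub>W2\<^esub> (g \<circ> b) i) \<in> supp c \<rightarrow> carrier W2"
        using cI bI linear_mapD(1)[OF gl] W2.smult_in by (auto simp: Pi_iff subset_iff)
    qed (use cI fa in auto)
    also have "\<dots> = g (\<psi> c)"
      unfolding \<psi>_def using linear_map_lin_ext[OF Pd W2 gl bI] c unfolding F_def by metis
    finally show ?thesis .
  qed
  define \<delta> :: "(nat \<times> point set \<times> (point \<Rightarrow> 'p)) \<times> point \<Rightarrow> 'p formal" where
    "\<delta> = (\<lambda>i j. if j = i then 1 else (0::real))"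
  have \<delta>F: "\<delta> i \<in> carrier F" if "i \<in> I" for i
  proof -
    have "supp (\<delta> i) = {i}" by (auto simp: supp_def \<delta>_def)
    then show ?thesis using that by (simp add: F_def free_vs_simps)
  qed
  have \<phi>\<delta>: "\<phi> (\<delta> i) = a i" and \<psi>\<delta>: "\<psi> (\<delta> i) = b i" if "i \<in> I" for i
    using that aI bI W1.lin_ext_basis[of a i] P.lin_ext_basis[of b i]
    unfolding \<phi>_def \<psi>_def \<delta>_def by auto
  have sub: "linear_subduction F P \<psi>"
    unfolding linear_subduction_def
  proof (intro conjI \<psi>s allI impI ballI)
    show "\<psi> ` carrier F = carrier P"
    proof
      show "\<psi> ` carrier F \<subseteq> carrier P" using linear_mapD(1)[OF \<psi>l] by auto
      show "carrier P \<subseteq> \<psi> ` carrier F"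
      proof
        fix x assume x: "x \<in> carrier P"
        have "g x \<in> f ` carrier W1"
          using linear_mapD(1)[OF gl x] f unfolding linear_subduction_def by auto
        then obtain w where w: "w \<in> carrier W1" "f w = g x" by auto
        let ?U = "topspace (Euclidean_space 0)"
        have U: "openin (Euclidean_space 0) ?U" by simp
        let ?i = "((0::nat, ?U, \<lambda>_::point. x), (\<lambda>_. 0) :: point)"
        have "lifts (fst ?i) (\<lambda>_. w)"
          unfolding lifts_def using W1.plot_const[OF U w(1)] w(2) by simp
        then have "liftable (fst ?i)" unfolding liftable_def by blast
        then have "?i \<in> I"
          using P.plot_const[OF U x] unfolding I_def by (auto simp: topspace_Euclidean_space)
        then show "x \<in> \<psi> ` carrier F"
          using \<psi>\<delta>[of ?i] \<delta>F[of ?i] by (intro image_eqI[of _ _ "\<delta> ?i"]) (auto simp: b_def)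
      qed
    qed
  next
    fix n U p x assume p: "plot P n U p" and x: "x \<in> U"
    have gp: "plot W2 n U (g \<circ> p)"
      using g p unfolding smooth_linear_def smooth_map_def by blast
    obtain U' q where U': "openin (Euclidean_space n) U'" "x \<in> U'" "U' \<subseteq> U"
      and q: "plot W1 n U' q" "\<forall>y\<in>U'. f (q y) = (g \<circ> p) y"
      using linear_subductionD[OF f gp x] by (elim exE conjE)
    have p': "plot P n U' p" by (rule P.plot_restrict[OF p U'(1,3)])
    have l: "liftable (n, U', p)" using q unfolding liftable_def lifts_def by auto
    define c where "c = (\<lambda>u. \<delta> ((n, U', p), u))"
    have iI: "((n, U', p), u) \<in> I" if "u \<in> U'" for u
      using that p' l unfolding I_def by simp
    have "plot F n U' c"
      unfolding pF initial_plot_def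
    proof (intro conjI)
      show "c \<in> U' \<rightarrow> carrier F" using \<delta>F iI unfolding c_def by auto
      have "plot W1 n U' (L (n, U', p))" using L[OF l] unfolding lifts_def by simp
      then show "plot W1 n U' (\<phi> \<circ> c)"
        by (rule W1.plot_cong) (simp add: c_def \<phi>\<delta>[OF iI] a_def)
      show "plot P n U' (\<psi> \<circ> c)"
        by (rule P.plot_cong[OF p']) (simp add: c_def \<psi>\<delta>[OF iI] b_def)
    qed
    moreover have "\<forall>y\<in>U'. \<psi> (c y) = p y" by (simp add: c_def \<psi>\<delta>[OF iI] b_def)
    ultimately show "\<exists>U' q. openin (Euclidean_space n) U' \<and> x \<in> U' \<and> U' \<subseteq> U \<and>
                       plot F n U' q \<and> (\<forall>y\<in>U'. \<psi> (q y) = p y)"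
      using U' by blast
  qed
  define e :: "'p \<Rightarrow> 'p formal" where
    "e = (\<lambda>x j. if j = ((0, {}, \<lambda>_. x), \<lambda>_. 0) then 1 else 0)"
  have e: "inj_on e A" for A
  proof (rule inj_onI)
    fix x y assume "e x = e y"
    then have "e x ((0, {}, \<lambda>_. x), \<lambda>_. 0) = e y ((0, {}, \<lambda>_. x), \<lambda>_. 0)" by simp
    then have "(\<lambda>_::point. x) = (\<lambda>_. y)" by (auto simp: e_def split: if_splits)
    then show "x = y" by (rule fun_cong)
  qed
  let ?T = "transport e P" and ?d = "inv_into (carrier P) e"
  note T = transport[OF Pd e]
  have "linear_subduction F ?T (e \<circ> \<psi>)"
    unfolding linear_subduction_def
  proof (intro conjI allI impI ballI smooth_linear_comp[OF \<psi>s T(2)])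
    show "(e \<circ> \<psi>) ` carrier F = carrier ?T"
    proof -
      have "\<psi> ` carrier F = carrier P" using sub unfolding linear_subduction_def by blast
      then have "(e \<circ> \<psi>) ` carrier F = e ` carrier P" by (metis image_comp)
      then show ?thesis by (simp add: transport_def Let_def)
    qed
  next
    fix n U p x assume p: "plot ?T n U p" and x: "x \<in> U"
    have dp: "plot P n U (?d \<circ> p)" using p by (simp add: transport_def Let_def)
    obtain U' q where U': "openin (Euclidean_space n) U'" "x \<in> U'" "U' \<subseteq> U"
      and q: "plot F n U' q" "\<forall>y\<in>U'. \<psi> (q y) = (?d \<circ> p) y"
      using linear_subductionD[OF sub dp x] by (elim exE conjE)
    have "e (\<psi> (q y)) = p y" if "y \<in> U'" for y
    proof -
      have "p y \<in> e ` carrier P" using p that U'(3) by (auto simp: transport_def Let_def)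
      then show ?thesis using q(2) that by (simp add: f_inv_into_f)
    qed
    then show "\<exists>U' q. openin (Euclidean_space n) U' \<and> x \<in> U' \<and> U' \<subseteq> U \<and>
                       plot F n U' q \<and> (\<forall>y\<in>U'. (e \<circ> \<psi>) (q y) = p y)"
      using U' q(1) by auto
  qed
  then obtain s where s: "smooth_linear P F s" and es: "\<forall>x\<in>carrier P. e x = (e \<circ> \<psi>) (s x)"
    using P F T(1,2) unfolding projective_def by blast
  have sF: "s x \<in> carrier F" if "x \<in> carrier P" for x
    using s that unfolding smooth_linear_def linear_map_def by auto
  have "g x = f ((\<phi> \<circ> s) x)" if x: "x \<in> carrier P" for x
  proof -
    have "\<psi> (s x) = x" using es x inj_onD[OF e[of UNIV], of x "\<psi> (s x)"] by auto
    then show ?thesis using f\<phi>[OF sF[OF x]] by simp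
  qed
  then show ?thesis using smooth_linear_comp[OF s \<phi>s] by blast
qed

end

theory Submission
  imports Defs
begin

text \<open>
  \<open>P(V)\<close> is the free diffeological vector space on the disjoint union of the domains of all
  plots of \<open>V\<close>; a plot of \<open>V\<close> lifts to the inclusion of its own domain.  By the universal
  property, projectivity of \<open>P(V)\<close> means that a plot lifts globally along a linear subduction.
  As the fibres are affine, local lifts can be glued with a partition of unity.
\<close>

section \<open>Smooth functions\<close>

text \<open>The plots of \<open>P(V)\<close> are never described explicitly. Its diffeology is an
  intersection; beyond its being a vector space diffeology, all that is used is that the generators
  are plots and that a linear map out of \<open>P(V)\<close> is smooth once its composites with the
  generators are plots. The burden falls on the lifting: values must be prescribed on the whole
  domain of each generator, whereas a linear subduction offers lifts near each point only, and two
  of these may differ on an overlap by a parametrization of the kernel. In an abstract diffeological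
  vector space infinite sums have no meaning a priori. The partition of unity is therefore built
  along a sequence of bumps, so that near every point finitely many terms remain and the locality
  axiom applies.\<close>

lemma cont_diff_continuous:
  "cont_diff k n U f \<Longrightarrow> continuous_map (subtopology (Euclidean_space n) U) euclideanreal f"
  by (cases k) auto

lemma cont_diff_SucI:
  assumes "continuous_map (subtopology (Euclidean_space n) U) euclideanreal f"
    and "\<And>i x. i < n \<Longrightarrow> x \<in> U \<Longrightarrow> ((\<lambda>t. f (x(i := t))) has_real_derivative g i x) (at (x i))"
    and "\<And>i. i < n \<Longrightarrow> cont_diff k n U (g i)"
  shows "cont_diff (Suc k) n U f"
  using assms by auto

lemma cont_diff_SucE:
  assumes "cont_diff (Suc k) n U f"
  obtains g where
    "\<And>i x. i < n \<Longrightarrow> x \<in> U \<Longrightarrow> ((\<lambda>t. f (x(i := t))) has_real_derivative g i x) (at (x i))"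
    "\<And>i. i < n \<Longrightarrow> cont_diff k n U (g i)"
  using assms by auto

text \<open>Used in the product and chain rules, whose derivative formulas contain the original
  functions besides their derivatives.\<close>

lemma cont_diff_Suc_imp: "cont_diff (Suc k) n U f \<Longrightarrow> cont_diff k n U f"
proof (induction k arbitrary: f)
  case 0
  then show ?case by simp
next
  case (Suc k)
  obtain g where
    "\<And>i x. i < n \<Longrightarrow> x \<in> U \<Longrightarrow> ((\<lambda>t. f (x(i := t))) has_real_derivative g i x) (at (x i))"
    "\<And>i. i < n \<Longrightarrow> cont_diff (Suc k) n U (g i)"
    using Suc.prems by (elim cont_diff_SucE) blast
  then show ?case
    by (intro cont_diff_SucI[OF cont_diff_continuous[OF Suc.prems], of g k] Suc.IH)
qed

lemma cont_diff_add:
  "cont_diff k n U f \<Longrightarrow> cont_diff k n U h \<Longrightarrow> cont_diff k n U (\<lambda>x. f x + h x)"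
proof (induction k arbitrary: f h)
  case 0
  then show ?case by (auto intro: continuous_map_add)
next
  case (Suc k)
  obtain f' where f':
    "\<And>i x. i < n \<Longrightarrow> x \<in> U \<Longrightarrow> ((\<lambda>t. f (x(i := t))) has_real_derivative f' i x) (at (x i))"
    "\<And>i. i < n \<Longrightarrow> cont_diff k n U (f' i)"
    using Suc.prems(1) by (elim cont_diff_SucE) blast
  obtain h' where h':
    "\<And>i x. i < n \<Longrightarrow> x \<in> U \<Longrightarrow> ((\<lambda>t. h (x(i := t))) has_real_derivative h' i x) (at (x i))"
    "\<And>i. i < n \<Longrightarrow> cont_diff k n U (h' i)"
    using Suc.prems(2) by (elim cont_diff_SucE) blast
  show ?case
  proof (rule cont_diff_SucI[where g = "\<lambda>i x. f' i x + h' i x"])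
    show "continuous_map (subtopology (Euclidean_space n) U) euclideanreal (\<lambda>x. f x + h x)"
      using Suc.prems by (intro continuous_map_add) (auto dest: cont_diff_continuous)
  qed (intro DERIV_add f'(1) h'(1) Suc.IH f'(2) h'(2); assumption)+
qed

lemma cont_diff_mult:
  "cont_diff k n U f \<Longrightarrow> cont_diff k n U h \<Longrightarrow> cont_diff k n U (\<lambda>x. f x * h x)"
proof (induction k arbitrary: f h)
  case 0
  then show ?case by (auto intro: continuous_map_real_mult)
next
  case (Suc k)
  obtain f' where f':
    "\<And>i x. i < n \<Longrightarrow> x \<in> U \<Longrightarrow> ((\<lambda>t. f (x(i := t))) has_real_derivative f' i x) (at (x i))"
    "\<And>i. i < n \<Longrightarrow> cont_diff k n U (f' i)"
    using Suc.prems(1) by (elim cont_diff_SucE) blast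
  obtain h' where h':
    "\<And>i x. i < n \<Longrightarrow> x \<in> U \<Longrightarrow> ((\<lambda>t. h (x(i := t))) has_real_derivative h' i x) (at (x i))"
    "\<And>i. i < n \<Longrightarrow> cont_diff k n U (h' i)"
    using Suc.prems(2) by (elim cont_diff_SucE) blast
  show ?case
  proof (rule cont_diff_SucI[where g = "\<lambda>i x. f' i x * h x + h' i x * f x"])
    show "continuous_map (subtopology (Euclidean_space n) U) euclideanreal (\<lambda>x. f x * h x)"
      using Suc.prems by (intro continuous_map_real_mult) (auto dest: cont_diff_continuous)
  next
    fix i x assume "i < n" "x \<in> U"
    then show "((\<lambda>t. f (x(i := t)) * h (x(i := t))) has_real_derivative
        f' i x * h x + h' i x * f x) (at (x i))"
      using DERIV_mult[OF f'(1)[of i x] h'(1)[of i x]] by simp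
  next
    fix i assume "i < n"
    then show "cont_diff k n U (\<lambda>x. f' i x * h x + h' i x * f x)"
      by (intro cont_diff_add Suc.IH f'(2) h'(2) cont_diff_Suc_imp[OF Suc.prems(1)]
          cont_diff_Suc_imp[OF Suc.prems(2)])
  qed
qed

lemma smooth_real_const: "smooth_real n U (\<lambda>_. c)"
  and smooth_real_proj: "smooth_real n U (\<lambda>x. x i)"
  by (simp_all add: smooth_real_def cont_diff_const cont_diff_proj)

lemma smooth_real_add:
  "smooth_real n U f \<Longrightarrow> smooth_real n U h \<Longrightarrow> smooth_real n U (\<lambda>x. f x + h x)"
  by (simp add: smooth_real_def cont_diff_add)

lemma smooth_real_mult:
  "smooth_real n U f \<Longrightarrow> smooth_real n U h \<Longrightarrow> smooth_real n U (\<lambda>x. f x * h x)"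
  by (simp add: smooth_real_def cont_diff_mult)

lemma smooth_real_diff:
  "smooth_real n U f \<Longrightarrow> smooth_real n U h \<Longrightarrow> smooth_real n U (\<lambda>x. f x - h x)"
  using smooth_real_add[OF _ smooth_real_mult[OF smooth_real_const[where c = "-1"]]] by simp

lemma smooth_real_sum:
  "(\<And>i. i \<in> A \<Longrightarrow> smooth_real n U (f i)) \<Longrightarrow> smooth_real n U (\<lambda>x. \<Sum>i\<in>A. f i x)"
  by (induction A rule: infinite_finite_induct)
     (auto intro: smooth_real_const smooth_real_add)

lemma smooth_real_prod:
  "(\<And>i. i \<in> A \<Longrightarrow> smooth_real n U (f i)) \<Longrightarrow> smooth_real n U (\<lambda>x. \<Prod>i\<in>A. f i x)"
  by (induction A rule: infinite_finite_induct)
     (auto intro: smooth_real_const smooth_real_mult)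

section \<open>Flat functions and a smooth step\<close>

definition flat :: "nat \<Rightarrow> real \<Rightarrow> real" where
  "flat k t = (if t > 0 then exp (- 1 / t) / t ^ k else 0)"

text \<open>The substitution of \<open>inverse t\<close> turns the limit from the right into the
  growth of \<open>exp\<close> against powers at infinity.\<close>

lemma flat_tendsto_0: "(flat k \<longlongrightarrow> 0) (at 0)"
proof (rule filterlim_split_at)
  show "(flat k \<longlongrightarrow> 0) (at_left 0)"
    by (rule tendsto_eventually)
       (auto simp: flat_def eventually_at_filter intro!: always_eventually)
  have "((\<lambda>t. inverse t ^ k / exp (inverse t)) \<longlongrightarrow> (0::real)) (at_right 0)"
    by (rule filterlim_compose[OF tendsto_power_div_exp_0 filterlim_inverse_at_top_right])
  moreover have "\<forall>\<^sub>F t in at_right 0. inverse t ^ k / exp (inverse t) = flat k t"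
    by (auto simp: flat_def eventually_at_filter exp_minus field_simps intro!: always_eventually)
  ultimately show "(flat k \<longlongrightarrow> 0) (at_right 0)"
    by (rule Lim_transform_eventually)
qed

text \<open>The functions \<open>exp (- 1 / t) / t ^ k\<close> are closed under differentiation up
  to linear combinations. This is the reason for the index \<open>k\<close>, although the step
  function is built from \<open>flat 0\<close> alone.\<close>

lemma flat_has_derivative:
  "(flat k has_real_derivative flat (k + 2) t - real k * flat (k + 1) t) (at t)"
proof -
  consider "t > 0" | "t < 0" | "t = 0" by linarith
  then show ?thesis
  proof cases
    case 1
    have "((\<lambda>t. exp (- 1 / t) / t ^ k) has_real_derivative
            flat (k + 2) t - real k * flat (k + 1) t) (at t)"
      using 1 by (auto intro!: derivative_eq_intros simp: flat_def)
         (cases k; simp add: field_simps power2_eq_square)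
    then show ?thesis
      by (rule DERIV_cong_ev[OF refl _ refl, THEN iffD1, rotated])
         (use 1 in \<open>auto simp: flat_def intro!: eventually_nhds_in_open[THEN eventually_mono, of "{0<..}"]\<close>)
  next
    case 2
    have "((\<lambda>_. 0) has_real_derivative flat (k + 2) t - real k * flat (k + 1) t) (at t)"
      using 2 by (simp add: flat_def)
    then show ?thesis
      by (rule DERIV_cong_ev[OF refl _ refl, THEN iffD1, rotated])
         (use 2 in \<open>auto simp: flat_def intro!: eventually_nhds_in_open[THEN eventually_mono, of "{..<0}"]\<close>)
  next
    case 3
    \<comment> \<open>The difference quotient at 0 is again a member of the family, so the
      derivative at 0 is the limit already computed.\<close>
    have "(flat k (0 + h) - flat k 0) / h = flat (k + 1) h" for h
      by (simp add: flat_def)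
    then have "(flat k has_real_derivative 0) (at 0)"
      using flat_tendsto_0[of "k + 1"] by (simp only: DERIV_def)
    then show ?thesis using 3 by (simp add: flat_def)
  qed
qed

lemma continuous_on_flat: "continuous_on UNIV (flat k)"
  using flat_has_derivative DERIV_isCont by (blast intro: continuous_at_imp_continuous_on)

text \<open>The chain rule raises the index of \<open>flat\<close>, so the induction on the order of
  differentiability treats all \<open>k\<close> at once.\<close>

lemma cont_diff_flat: "cont_diff m n U u \<Longrightarrow> cont_diff m n U (\<lambda>x. flat k (u x))"
proof (induction m arbitrary: k)
  case 0
  then show ?case
    using continuous_map_compose[of _ euclideanreal u euclideanreal "flat k"] continuous_on_flat
    by (simp add: comp_def)
next
  case (Suc m)
  obtain u' where u':
    "\<And>i x. i < n \<Longrightarrow> x \<in> U \<Longrightarrow> ((\<lambda>t. u (x(i := t))) has_real_derivative u' i x) (at (x i))"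
    "\<And>i. i < n \<Longrightarrow> cont_diff m n U (u' i)"
    using Suc.prems by (elim cont_diff_SucE) blast
  let ?F = "\<lambda>x. flat (k + 2) (u x) + - real k * flat (k + 1) (u x)"
  show ?case
  proof (rule cont_diff_SucI[where g = "\<lambda>i x. ?F x * u' i x"])
    show "continuous_map (subtopology (Euclidean_space n) U) euclideanreal (\<lambda>x. flat k (u x))"
      using continuous_map_compose[OF cont_diff_continuous[OF Suc.prems], of euclideanreal "flat k"]
        continuous_on_flat by (simp add: comp_def)
  next
    fix i x assume "i < n" "x \<in> U"
    then show "((\<lambda>t. flat k (u (x(i := t)))) has_real_derivative ?F x * u' i x) (at (x i))"
      using DERIV_chain2[OF flat_has_derivative u'(1)[of i x], of k] by simp
  next
    fix i assume "i < n"
    then show "cont_diff m n U (\<lambda>x. ?F x * u' i x)"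
      by (intro cont_diff_mult cont_diff_add Suc.IH cont_diff_const u'(2)
          cont_diff_Suc_imp[OF Suc.prems])
  qed
qed

text \<open>Built by composition only, so that reciprocals of smooth functions are not needed.\<close>

definition smooth_step :: "real \<Rightarrow> real" where
  "smooth_step t = exp 1 * flat 0 (1 - exp 1 * flat 0 (1 - t))"

text \<open>For these \<open>t\<close> the inner \<open>flat\<close> vanishes, and the factor
  \<open>exp 1\<close> is the reciprocal of \<open>flat 0 1\<close>.\<close>

lemma smooth_step_1: "t \<ge> 1 \<Longrightarrow> smooth_step t = 1"
  by (simp add: smooth_step_def flat_def flip: exp_add)

lemma smooth_step_0:
  assumes "t \<le> 0"
  shows "smooth_step t = 0"
proof -
  \<comment> \<open>Since \<open>1 / (1 - t) \<le> 1\<close>, this term is at least 1, which makes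
    the argument of the outer \<open>flat\<close> nonpositive.\<close>
  have "exp 1 * flat 0 (1 - t) = exp (1 - 1 / (1 - t))"
    using assms by (simp add: flat_def flip: exp_add)
  also have "\<dots> \<ge> 1" using assms by (simp add: field_simps)
  finally show ?thesis by (simp add: smooth_step_def flat_def)
qed

lemma smooth_real_flat: "smooth_real n U u \<Longrightarrow> smooth_real n U (\<lambda>x. flat k (u x))"
  by (simp add: smooth_real_def cont_diff_flat)

lemma smooth_real_step: "smooth_real n U u \<Longrightarrow> smooth_real n U (\<lambda>x. smooth_step (u x))"
  unfolding smooth_step_def
  by (intro smooth_real_mult smooth_real_diff smooth_real_flat smooth_real_const)

section \<open>Bump functions\<close>

lemma Euclidean_space_box:
  assumes "openin (Euclidean_space n) U" "a \<in> U"
  obtains r where "r > 0"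
    "\<And>x. x \<in> topspace (Euclidean_space n) \<Longrightarrow> (\<And>i. i < n \<Longrightarrow> \<bar>x i - a i\<bar> < r) \<Longrightarrow> x \<in> U"
proof -
  obtain T where T: "openin (powertop_real UNIV) T" "U = T \<inter> {x. \<forall>i\<ge>n. x i = 0}"
    using assms(1) unfolding Euclidean_space_def openin_subtopology by blast
  obtain B where B: "\<And>i. open (B i)" "a \<in> PiE UNIV B" "PiE UNIV B \<subseteq> T"
  proof -
    have "a \<in> T" using T(2) assms(2) by blast
    from openin_product_topology_alt[THEN iffD1, OF T(1), rule_format, OF this]
    obtain B where "\<forall>i\<in>UNIV. openin euclideanreal (B i)" "a \<in> PiE UNIV B" "PiE UNIV B \<subseteq> T"
      by (elim exE conjE)
    then show ?thesis by (intro that[of B]) simp_all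
  qed
  have "\<exists>r>0. ball (a i) r \<subseteq> B i" for i
    using B(1)[of i] B(2) by (auto simp: open_contains_ball)
  then obtain r where r: "\<And>i. r i > 0" "\<And>i. ball (a i) (r i) \<subseteq> B i" by metis
  \<comment> \<open>Beyond the first \<open>n\<close> coordinates both points are 0, so finitely
    many radii matter; the 1 keeps the set nonempty when \<open>n = 0\<close>.\<close>
  define \<rho> where "\<rho> = Min (insert 1 (r ` {..<n}))"
  show ?thesis
  proof
    show "\<rho> > 0" using r(1) by (auto simp: \<rho>_def)
    fix x assume x: "x \<in> topspace (Euclidean_space n)" and d: "\<And>i. i < n \<Longrightarrow> \<bar>x i - a i\<bar> < \<rho>"
    have x0: "x i = 0" if "i \<ge> n" for i using x that by (simp add: topspace_Euclidean_space)
    have "x i \<in> B i" for i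
    proof (cases "i < n")
      case True
      then have "\<rho> \<le> r i" by (auto simp: \<rho>_def)
      then show ?thesis using d[OF True] r(2)[of i] by (auto simp: dist_real_def)
    next
      case False
      then have "x i = a i" using assms(2) T(2) x0 by auto
      then show ?thesis using B(2) by auto
    qed
    then show "x \<in> U" using B(3) T(2) x0 by auto
  qed
qed

text \<open>The open set \<open>C\<close> stands in for the complement of the support: as
  \<open>U\<close> and \<open>C\<close> cover the space, a plot multiplied by \<open>\<phi>\<close>
  can be extended by zero through the locality axiom. That \<open>\<phi>\<close> is 1 on an open
  set, and not only at \<open>a\<close>, lets these sets serve as a cover later.\<close>

lemma smooth_bump:
  assumes U: "openin (Euclidean_space n) U" "a \<in> U"
  obtains \<phi> N C where "\<And>W. smooth_real n W \<phi>"
    "openin (Euclidean_space n) N" "a \<in> N" "N \<subseteq> U" "\<And>x. x \<in> N \<Longrightarrow> \<phi> x = 1"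
    "openin (Euclidean_space n) C" "U \<union> C = topspace (Euclidean_space n)"
    "\<And>x. x \<in> C \<Longrightarrow> \<phi> x = 0"
proof -
  let ?E = "Euclidean_space n"
  obtain r where r: "r > 0"
    "\<And>x. x \<in> topspace ?E \<Longrightarrow> (\<And>i. i < n \<Longrightarrow> \<bar>x i - a i\<bar> < r) \<Longrightarrow> x \<in> U"
    using Euclidean_space_box[OF U] by blast
  define \<psi> :: "point \<Rightarrow> real" where "\<psi> = (\<lambda>x. \<Sum>i<n. (x i - a i) * (x i - a i))"
  \<comment> \<open>The squared distance \<open>\<psi>\<close> is a polynomial, hence smooth. The
    bump is 1 for \<open>\<psi>\<close> below \<open>\<delta>\<close> and 0 above
    \<open>2 * \<delta>\<close>, while all points below \<open>3 * \<delta>\<close> lie in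
    \<open>U\<close>; the gap between the last two thresholds makes \<open>U\<close> and
    \<open>C\<close> cover.\<close>
  define \<delta> where "\<delta> = r * r / 3"
  have \<delta>: "\<delta> > 0" using r(1) by (simp add: \<delta>_def)
  have s: "smooth_real n W \<psi>" for W
    unfolding \<psi>_def
    by (intro smooth_real_sum smooth_real_mult smooth_real_diff smooth_real_proj smooth_real_const)
  have c: "continuous_map ?E euclideanreal \<psi>"
    using s[of "topspace ?E"] cont_diff_continuous[of 0 n "topspace ?E" \<psi>]
    by (auto simp: smooth_real_def)
  have in_U: "x \<in> U" if x: "x \<in> topspace ?E" "\<psi> x < 3 * \<delta>" for x
  proof (rule r(2)[OF x(1)])
    fix i assume i: "i < n"
    have "(x i - a i) * (x i - a i) \<le> \<psi> x"
      unfolding \<psi>_def using i by (intro member_le_sum) auto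
    also have "\<dots> < r * r" using x(2) by (simp add: \<delta>_def)
    finally show "\<bar>x i - a i\<bar> < r"
      using r(1) by (intro power2_less_imp_less[of _ r]) (simp_all add: power2_eq_square)
  qed
  show ?thesis
  proof (rule that[of "\<lambda>x. smooth_step (2 - 1 / \<delta> * \<psi> x)"
          "{x \<in> topspace ?E. \<psi> x \<in> {..<\<delta>}}" "{x \<in> topspace ?E. \<psi> x \<in> {2 * \<delta><..}}"])
    show "smooth_real n W (\<lambda>x. smooth_step (2 - 1 / \<delta> * \<psi> x))" for W
      by (intro smooth_real_step smooth_real_mult smooth_real_diff smooth_real_const s)
    show "openin ?E {x \<in> topspace ?E. \<psi> x \<in> {..<\<delta>}}"
      "openin ?E {x \<in> topspace ?E. \<psi> x \<in> {2 * \<delta><..}}"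
      by (rule openin_continuous_map_preimage[OF c], simp)+
    show "a \<in> {x \<in> topspace ?E. \<psi> x \<in> {..<\<delta>}}"
      using \<delta> U openin_subset[OF U(1)] by (auto simp: \<psi>_def)
    show "{x \<in> topspace ?E. \<psi> x \<in> {..<\<delta>}} \<subseteq> U" using in_U \<delta> by auto
    show "U \<union> {x \<in> topspace ?E. \<psi> x \<in> {2 * \<delta><..}} = topspace ?E"
      using in_U \<delta> openin_subset[OF U(1)] by force
  qed (use \<delta> in \<open>auto intro!: smooth_step_1 smooth_step_0 simp: field_simps\<close>)
qed

section \<open>Global lifts along linear subductions\<close>

text \<open>Open sets of \<open>Euclidean_space n\<close> are traces of open sets of the sequence
  space \<open>point\<close>, which is second countable. Countability allows the local lifts to be
  arranged in a sequence.\<close>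

lemma Lindelof_Euclidean_space:
  assumes "\<And>S. S \<in> \<N> \<Longrightarrow> openin (Euclidean_space n) S"
  obtains \<N>' where "\<N>' \<subseteq> \<N>" "countable \<N>'" "\<Union>\<N>' = \<Union>\<N>"
proof -
  have "\<exists>T. open T \<and> S = T \<inter> topspace (Euclidean_space n)" if "S \<in> \<N>" for S
    using assms[OF that] unfolding Euclidean_space_def openin_subtopology
    by (auto simp: euclidean_product_topology)
  then obtain T where T: "\<And>S. S \<in> \<N> \<Longrightarrow> open (T S)"
    "\<And>S. S \<in> \<N> \<Longrightarrow> S = T S \<inter> topspace (Euclidean_space n)" by metis
  obtain \<T> where \<T>: "\<T> \<subseteq> T ` \<N>" "countable \<T>" "\<Union>\<T> = \<Union>(T ` \<N>)"
    using Lindelof[of "T ` \<N>"] T(1) by blast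
  obtain \<N>' where N': "\<N>' \<subseteq> \<N>" "countable \<N>'" "\<T> = T ` \<N>'"
    using \<T>(1,2) by (metis countable_subset_image)
  have "\<Union>\<N> \<subseteq> \<Union>\<N>'"
  proof
    fix x assume "x \<in> \<Union>\<N>"
    then obtain S where S: "S \<in> \<N>" "x \<in> S" by blast
    then have x: "x \<in> T S" "x \<in> topspace (Euclidean_space n)" using T(2) by blast+
    then obtain S' where "S' \<in> \<N>'" "x \<in> T S'" using \<T>(3) N'(3) S(1) by blast
    then show "x \<in> \<Union>\<N>'" using x(2) T(2) N'(1) by blast
  qed
  then show ?thesis using N' by (intro that[of \<N>']) auto
qed

text \<open>
  The local lifts \<open>q\<^sub>j\<close> are glued with the partition of unity \<open>\<phi>\<^sub>j \<Prod>\<^bsub>i<j\<^esub> (1 - \<phi>\<^sub>i)\<close>; its partial sums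
  telescope to \<open>1 - \<Prod>\<^bsub>i<k\<^esub> (1 - \<phi>\<^sub>i)\<close>, and on the open set where \<open>\<phi>\<^sub>i = 1\<close> all terms
  beyond the \<open>i\<close>-th vanish.
\<close>

lemma linear_subduction_lift:
  assumes W1: "diff_vector_space W1" and W2: "diff_vector_space W2"
    and f: "linear_subduction W1 W2 f" and p: "plot W2 n U p"
  shows "\<exists>q. plot W1 n U q \<and> (\<forall>x\<in>U. f (q x) = p x)"
proof (cases "U = {}")
  case True
  have "plot W1 n U (\<lambda>_. \<zero>\<^bsub>W1\<^esub>)"
  proof -
    interpret W1: diff_vector_space W1 by fact
    show ?thesis using True by (intro W1.plot_const) auto
  qed
  then show ?thesis using True by auto
next
  case ne: False
  interpret W1: diff_vector_space W1 by fact
  interpret W2: diff_vector_space W2 by fact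
  let ?E = "Euclidean_space n"
  have fl: "linear_map W1 W2 f"
    using f unfolding linear_subduction_def smooth_linear_def by auto
  note fD = linear_mapD[OF fl]
  have U: "openin ?E U" by (rule W2.plot_open[OF p])
  have pin: "p x \<in> carrier W2" if "x \<in> U" for x using W2.plot_in[OF p that] .
  \<comment> \<open>Here \<open>q\<close> is a local lift already multiplied by
    \<open>\<phi>\<close> and extended by zero. It is a plot on all of \<open>U\<close>, so weighted
    lifts can be added without shrinking domains.\<close>
  define good where "good = (\<lambda>N \<phi> q. openin ?E N \<and> N \<subseteq> U \<and> smooth_real n U \<phi> \<and>
      (\<forall>x\<in>N. \<phi> x = 1) \<and> plot W1 n U q \<and> (\<forall>x\<in>U. f (q x) = \<phi> x \<odot>\<^bsub>W2\<^esub> p x))"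
  have local: "\<exists>N \<phi> q. a \<in> N \<and> good N \<phi> q" if a: "a \<in> U" for a
  proof -
    obtain U' q where U': "openin ?E U'" "a \<in> U'" "U' \<subseteq> U"
      and q: "plot W1 n U' q" "\<forall>y\<in>U'. f (q y) = p y"
      using linear_subductionD[OF f p a] by blast
    obtain \<phi> N C where \<phi>: "\<And>W. smooth_real n W \<phi>"
      and N: "openin ?E N" "a \<in> N" "N \<subseteq> U'" "\<And>x. x \<in> N \<Longrightarrow> \<phi> x = 1"
      and C: "openin ?E C" "U' \<union> C = topspace ?E" "\<And>x. x \<in> C \<Longrightarrow> \<phi> x = 0"
      by (rule smooth_bump[OF U'(1,2)]) blast
    \<comment> \<open>Two open pieces cover \<open>U\<close>: on \<open>U'\<close> the product is a
      plot, and on \<open>U \<inter> C\<close> it is constantly zero.\<close>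
    define Q where "Q = (\<lambda>x. if x \<in> U' then \<phi> x \<odot>\<^bsub>W1\<^esub> q x else \<zero>\<^bsub>W1\<^esub>)"
    have Qin: "Q x \<in> carrier W1" for x
      unfolding Q_def using W1.plot_in[OF q(1)] W1.smult_in by auto
    have "plot W1 n U' (\<lambda>x. \<phi> x \<odot>\<^bsub>W1\<^esub> q x)"
      using q(1) U'(1) \<phi> by (intro W1.plot_smult) (auto simp: real_diffeology_def)
    then have QU': "plot W1 n U' Q"
      by (rule W1.plot_cong) (simp add: Q_def)
    have UC: "openin ?E (U \<inter> C)" using U C(1) by blast
    have Q0: "Q x = \<zero>\<^bsub>W1\<^esub>" if "x \<in> C" for x
      using C(3)[OF that] W1.plot_in[OF q(1)] W1.smult_zero_left by (auto simp: Q_def)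
    have "plot W1 n (U \<inter> C) (\<lambda>_. \<zero>\<^bsub>W1\<^esub>)"
      by (rule W1.plot_const[OF UC]) simp
    then have QC: "plot W1 n (U \<inter> C) Q"
      by (rule W1.plot_cong) (simp add: Q0)
    have UU'C: "U \<subseteq> U' \<union> C" unfolding C(2) by (rule openin_subset[OF U])
    then have cover: "\<Union>{U', U \<inter> C} = U" using U'(3) by auto
    have "plot W1 n (\<Union>{U', U \<inter> C}) Q"
      by (rule W1.plot_local) (use U'(1) UC QU' QC Qin in auto)
    then have "plot W1 n U Q" unfolding cover .
    moreover have "f (Q x) = \<phi> x \<odot>\<^bsub>W2\<^esub> p x" if x: "x \<in> U" for x
    proof (cases "x \<in> U'")
      case True
      then show ?thesis using fD(3) W1.plot_in[OF q(1)] q(2) by (simp add: Q_def)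
    next
      case False
      then have "x \<in> C" using UU'C x by blast
      then show ?thesis
        using Q0 C(3) W2.smult_zero_left[OF pin[OF x]] linear_map_zero[OF W1 W2 fl] by simp
    qed
    ultimately have "good N \<phi> Q" using N U'(3) \<phi> unfolding good_def by blast
    then show ?thesis using N(2) by blast
  qed
  define \<N> where "\<N> = {N. \<exists>\<phi> q. good N \<phi> q}"
  have \<N>_sub: "N \<subseteq> U" "openin ?E N" if "N \<in> \<N>" for N
    using that unfolding \<N>_def good_def by auto
  have \<N>U: "\<Union>\<N> = U"
  proof
    show "\<Union>\<N> \<subseteq> U" using \<N>_sub(1) by auto
    show "U \<subseteq> \<Union>\<N>"
    proof
      fix a assume "a \<in> U"
      from local[OF this] show "a \<in> \<Union>\<N>" unfolding \<N>_def by blast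
    qed
  qed
  obtain \<N>' where N': "\<N>' \<subseteq> \<N>" "countable \<N>'" "\<Union>\<N>' = \<Union>\<N>"
    using Lindelof_Euclidean_space[OF \<N>_sub(2)] by metis
  \<comment> \<open>Only a nonempty countable family is the range of a sequence, hence the separate
    case of an empty domain.\<close>
  have "\<N>' \<noteq> {}" using ne N'(3) \<N>U by auto
  define N where "N = from_nat_into \<N>'"
  have rN: "range N = \<N>'"
    unfolding N_def by (rule range_from_nat_into) fact+
  then have "\<exists>\<phi> q. good (N j) \<phi> q" for j using N'(1) unfolding \<N>_def by blast
  then obtain \<phi> q where good: "\<And>j. good (N j) (\<phi> j) (q j)" by metis
  have N: "openin ?E (N j)" "N j \<subseteq> U" and \<phi>: "smooth_real n U (\<phi> j)"
    and \<phi>1: "\<And>x. x \<in> N j \<Longrightarrow> \<phi> j x = 1" and q: "plot W1 n U (q j)"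
    and fq: "\<And>x. x \<in> U \<Longrightarrow> f (q j x) = \<phi> j x \<odot>\<^bsub>W2\<^esub> p x" for j
    using good[of j] unfolding good_def by (elim conjE, simp)+
  have NU: "\<Union>(range N) = U" using rN N'(3) \<N>U by simp
  define R where "R = (\<lambda>k x. \<Prod>i<k. 1 - \<phi> i x)"
  \<comment> \<open>The weight is \<open>R k\<close> alone because \<open>q k\<close> already
    carries the factor \<open>\<phi> k\<close>.\<close>
  define S where "S = rec_nat (\<lambda>_. \<zero>\<^bsub>W1\<^esub>) (\<lambda>k s x. s x \<oplus>\<^bsub>W1\<^esub> R k x \<odot>\<^bsub>W1\<^esub> q k x)"
  have S0: "S 0 = (\<lambda>_. \<zero>\<^bsub>W1\<^esub>)"
    and SSuc: "S (Suc k) = (\<lambda>x. S k x \<oplus>\<^bsub>W1\<^esub> R k x \<odot>\<^bsub>W1\<^esub> q k x)" for k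
    by (simp_all add: S_def)
  have qin: "q k x \<in> carrier W1" if "x \<in> U" for k x by (rule W1.plot_in[OF q that])
  have Splot: "plot W1 n U (S k)" for k
  proof (induction k)
    case 0
    then show ?case unfolding S0 by (intro W1.plot_const U) simp
  next
    case (Suc k)
    have "smooth_real n U (R k)"
      unfolding R_def by (intro smooth_real_prod smooth_real_diff smooth_real_const \<phi>)
    then show ?case
      unfolding SSuc using Suc U q
      by (intro W1.plot_add W1.plot_smult) (auto simp: real_diffeology_def)
  qed
  have Sin: "S k x \<in> carrier W1" if "x \<in> U" for k x by (rule W1.plot_in[OF Splot that])
  have fS: "f (S k x) = (1 - R k x) \<odot>\<^bsub>W2\<^esub> p x" if x: "x \<in> U" for k x
  proof (induction k)
    case 0
    then show ?case
      using linear_map_zero[OF W1 W2 fl] W2.smult_zero_left[OF pin[OF x]] by (simp add: S0 R_def)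
  next
    case (Suc k)
    have "f (S (Suc k) x) = f (S k x) \<oplus>\<^bsub>W2\<^esub> R k x \<odot>\<^bsub>W2\<^esub> f (q k x)"
      unfolding SSuc using fD(2,3) Sin[OF x] qin[OF x] W1.smult_in by simp
    also have "\<dots> = (1 - R k x) \<odot>\<^bsub>W2\<^esub> p x \<oplus>\<^bsub>W2\<^esub> (R k x * \<phi> k x) \<odot>\<^bsub>W2\<^esub> p x"
      using Suc fq[OF x] W2.smult_assoc1[of "R k x" "\<phi> k x" "p x"] pin[OF x] by simp
    also have "\<dots> = (1 - R k x + R k x * \<phi> k x) \<odot>\<^bsub>W2\<^esub> p x"
      using W2.smult_l_distr[of "1 - R k x" "R k x * \<phi> k x" "p x"] pin[OF x] by simp
    also have "1 - R k x + R k x * \<phi> k x = 1 - R (Suc k) x"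
      by (simp add: R_def algebra_simps)
    finally show ?case .
  qed
  \<comment> \<open>The factor with index \<open>i\<close> occurs in \<open>R k\<close> only for
    \<open>k > i\<close>, so on \<open>N i\<close> the partial sums become stationary from
    \<open>Suc i\<close> on.\<close>
  have R0: "R k x = 0" if "x \<in> N i" "i < k" for i k x
    using that \<phi>1 by (auto simp: R_def intro!: prod_zero)
  have stable: "S k x = S (Suc i) x" if x: "x \<in> N i" and k: "Suc i \<le> k" for i k x
    using k
  proof (induction k rule: dec_induct)
    case (step k)
    have xU: "x \<in> U" using x N(2) by blast
    have "R k x = 0" using R0[OF x] step.hyps by simp
    then have "S (Suc k) x = S k x"
      using Sin[OF xU] W1.smult_zero_left[OF qin[OF xU]] by (simp add: SSuc)
    then show ?case using step.IH by simp
  qed simp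
  define m where "m = (\<lambda>x. LEAST i. x \<in> N i)"
  \<comment> \<open>The index varies with \<open>x\<close>, but \<open>m x \<le> i\<close> on
    \<open>N i\<close>, so \<open>L\<close> agrees there with the single plot
    \<open>S (Suc i)\<close>.\<close>
  define L where "L = (\<lambda>x. S (Suc (m x)) x)"
  have m: "x \<in> N (m x)" "m x \<le> i" if "x \<in> N i" for x i
    unfolding m_def using that by (rule LeastI, rule Least_le)
  have "plot W1 n (N i) L" for i
  proof -
    have "plot W1 n (N i) (S (Suc i))" by (rule W1.plot_restrict[OF Splot N])
    then show ?thesis
    proof (rule W1.plot_cong)
      fix x assume x: "x \<in> N i"
      show "S (Suc i) x = L x" unfolding L_def using m[OF x] by (intro stable) auto
    qed
  qed
  moreover have "L \<in> \<Union>(range N) \<rightarrow> carrier W1"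
    unfolding NU L_def using Sin by simp
  ultimately have "plot W1 n (\<Union>(range N)) L"
    using N(1) by (intro W1.plot_local) auto
  moreover have "f (L x) = p x" if x: "x \<in> U" for x
  proof -
    obtain i where "x \<in> N i" using x NU by blast
    then have "R (Suc (m x)) x = 0" using m(1) R0 by blast
    then show ?thesis unfolding L_def fS[OF x] using W2.smult_one[OF pin[OF x]] by simp
  qed
  ultimately show ?thesis using NU by auto
qed

section \<open>Free diffeological vector spaces\<close>

definition basis_vec :: "'i \<Rightarrow> 'i \<Rightarrow> real" where
  "basis_vec i = (\<lambda>j. if j = i then 1 else 0)"

definition admissible :: "'i set \<Rightarrow> 'i diffeology \<Rightarrow> ('i \<Rightarrow> real) diffeology \<Rightarrow> bool" where
  "admissible I G D \<longleftrightarrow> diff_vector_space (free_vs I D) \<and> (\<forall>n U b. G n U b \<longrightarrow> D n U (basis_vec \<circ> b))"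

text \<open>
  The finest vector space diffeology on the free vector space over \<open>I\<close> for which the
  parametrizations \<open>b\<close> with \<open>G n U b\<close> become plots.
\<close>

definition generated_plot :: "'i set \<Rightarrow> 'i diffeology \<Rightarrow> ('i \<Rightarrow> real) diffeology" where
  "generated_plot I G n U c \<longleftrightarrow>
     openin (Euclidean_space n) U \<and> c \<in> U \<rightarrow> carrier (free_vs I undefined) \<and>
     (\<forall>D. admissible I G D \<longrightarrow> D n U c)"

definition free_dvs :: "'i set \<Rightarrow> 'i diffeology \<Rightarrow> ('i \<Rightarrow> real) dvs" where
  "free_dvs I G = free_vs I (generated_plot I G)"

lemma basis_vec_in: "i \<in> I \<Longrightarrow> basis_vec i \<in> carrier (free_vs I D)"
  by (auto simp: free_vs_simps supp_def basis_vec_def)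

lemma admissibleD:
  assumes "admissible I G D"
  shows "diff_vector_space (free_vs I D)" "G n U b \<Longrightarrow> D n U (basis_vec \<circ> b)"
  using assms unfolding admissible_def by auto

lemma generated_plotI:
  assumes "openin (Euclidean_space n) U" "\<And>x. x \<in> U \<Longrightarrow> c x \<in> carrier (free_vs I undefined)"
    and "\<And>D. admissible I G D \<Longrightarrow> D n U c"
  shows "generated_plot I G n U c"
  unfolding generated_plot_def
proof (intro conjI allI impI)
  fix D assume "admissible I G D"
  then show "D n U c" by (rule assms(3)[of D])
qed (use assms(1,2) in auto)

lemma generated_plotD:
  assumes "generated_plot I G n U c"
  shows "openin (Euclidean_space n) U" "x \<in> U \<Longrightarrow> c x \<in> carrier (free_vs I undefined)"
    and "admissible I G D \<Longrightarrow> D n U c"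
  using assms unfolding generated_plot_def by auto

text \<open>Each axiom survives intersecting over the admissible diffeologies. The explicit openness
  and range conditions in \<open>generated_plot\<close> supply \<open>plot_open\<close> and
  \<open>plot_range\<close> before any admissible diffeology is known to exist.\<close>

lemma diffeological_space_generated_plot:
  "diffeological_space (carrier (free_vs I undefined)) (generated_plot I G)"
proof
  let ?F = "free_vs I undefined"
  have space: "diffeological_space (carrier ?F) D" if "admissible I G D" for D
    using diff_vector_space.axioms(2)[OF admissibleD(1)[OF that]] by (simp add: free_vs_simps)
  show "openin (Euclidean_space n) U" "p \<in> U \<rightarrow> carrier ?F" if "generated_plot I G n U p" for n U p
    using generated_plotD(1,2)[OF that] by auto
  show "generated_plot I G n U q" if p: "generated_plot I G n U p" and e: "\<And>x. x \<in> U \<Longrightarrow> p x = q x"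
    for n U p q
  proof (rule generated_plotI)
    show "q x \<in> carrier ?F" if "x \<in> U" for x
      using generated_plotD(2)[OF p that] by (simp only: e[OF that])
    show "D n U q" if "admissible I G D" for D
      by (rule diffeological_space.plot_cong[OF space[OF that] generated_plotD(3)[OF p that] e])
  qed (rule generated_plotD(1)[OF p])
  show "generated_plot I G n U (\<lambda>_. c)" if c: "openin (Euclidean_space n) U" "c \<in> carrier ?F" for n U c
  proof (rule generated_plotI)
    show "D n U (\<lambda>_. c)" if "admissible I G D" for D
      by (rule diffeological_space.plot_const[OF space[OF that] c])
  qed (rule c)+
  show "generated_plot I G m V (p \<circ> f)"
    if p: "generated_plot I G n U p" and f: "smooth_euclidean m V n U f" for n U p m V f
  proof (rule generated_plotI)
    have "f x \<in> U" if "x \<in> V" for x using f that unfolding smooth_euclidean_def by auto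
    then show "(p \<circ> f) x \<in> carrier ?F" if "x \<in> V" for x
      using generated_plotD(2)[OF p, of "f x"] that by simp
    show "D m V (p \<circ> f)" if "admissible I G D" for D
      using diffeological_space.plot_compose[OF space[OF that], of n U p m V f]
        generated_plotD(3)[OF p that] f by simp
  qed (use f in \<open>simp add: smooth_euclidean_def\<close>)
  show "generated_plot I G n (\<Union>\<U>) p"
    if o: "\<And>U. U \<in> \<U> \<Longrightarrow> openin (Euclidean_space n) U" and r: "p \<in> \<Union>\<U> \<rightarrow> carrier ?F"
      and l: "\<And>U. U \<in> \<U> \<Longrightarrow> generated_plot I G n U p" for \<U> n p
  proof (rule generated_plotI)
    show "D n (\<Union>\<U>) p" if "admissible I G D" for D
    proof (rule diffeological_space.plot_local[OF space[OF that], of \<U> n p])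
      show "D n U p" if "U \<in> \<U>" for U
        by (rule generated_plotD(3)[OF l[OF that] \<open>admissible I G D\<close>])
    qed (rule o r; assumption)+
    show "p x \<in> carrier ?F" if "x \<in> \<Union>\<U>" for x by (rule funcset_mem[OF r that])
  qed (use o in blast)
qed

text \<open>The algebraic operations of \<open>free_vs I D\<close> are the same for every
  \<open>D\<close>, so their smoothness passes to the intersection.\<close>

lemma diff_vector_space_free_dvs: "diff_vector_space (free_dvs I G)"
proof (rule diff_vector_spaceI)
  let ?F = "free_vs I undefined"
  have F: "carrier (free_dvs I G) = carrier ?F" "plot (free_dvs I G) = generated_plot I G"
    "add (free_dvs I G) = add ?F" "smult (free_dvs I G) = smult ?F"
    by (simp_all add: free_dvs_def free_vs_simps)
  show "Module.module real_ring (free_dvs I G)"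
    unfolding free_dvs_def by (rule module_free_vs)
  interpret Module.module real_ring ?F by (rule module_free_vs)
  show "diffeological_space (carrier (free_dvs I G)) (plot (free_dvs I G))"
    unfolding F by (rule diffeological_space_generated_plot)
  show "plot (free_dvs I G) n U (\<lambda>x. p x \<oplus>\<^bsub>free_dvs I G\<^esub> q x)"
    if "plot (free_dvs I G) n U p" "plot (free_dvs I G) n U q" for n U p q
    unfolding F
  proof (rule generated_plotI)
    note pq = that[unfolded F]
    show "openin (Euclidean_space n) U" by (rule generated_plotD(1)[OF pq(1)])
    show "p x \<oplus>\<^bsub>?F\<^esub> q x \<in> carrier ?F" if "x \<in> U" for x
      using generated_plotD(2)[OF pq(1) that] generated_plotD(2)[OF pq(2) that] by (rule a_closed)
    show "D n U (\<lambda>x. p x \<oplus>\<^bsub>?F\<^esub> q x)" if "admissible I G D" for D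
      using diff_vector_space.plot_add[OF admissibleD(1)[OF that], of n U p q]
        generated_plotD(3)[OF pq(1) that] generated_plotD(3)[OF pq(2) that]
      by (simp add: free_vs_simps)
  qed
  show "plot (free_dvs I G) n U (\<lambda>x. r x \<odot>\<^bsub>free_dvs I G\<^esub> q x)"
    if r: "real_diffeology n U r" and "plot (free_dvs I G) n U q" for n U r q
    unfolding F
  proof (rule generated_plotI)
    note q = that(2)[unfolded F]
    show "openin (Euclidean_space n) U" by (rule generated_plotD(1)[OF q])
    show "r x \<odot>\<^bsub>?F\<^esub> q x \<in> carrier ?F" if "x \<in> U" for x
      using generated_plotD(2)[OF q that] by (intro smult_closed) simp_all
    show "D n U (\<lambda>x. r x \<odot>\<^bsub>?F\<^esub> q x)" if "admissible I G D" for D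
      using diff_vector_space.plot_smult[OF admissibleD(1)[OF that], of n U r q] r
        generated_plotD(3)[OF q that] by (simp add: free_vs_simps)
  qed
qed

lemma free_dvs_generator:
  assumes "G n U b" "openin (Euclidean_space n) U" "b \<in> U \<rightarrow> I"
  shows "plot (free_dvs I G) n U (basis_vec \<circ> b)"
  unfolding free_dvs_def free_vs_simps(5)
proof (rule generated_plotI[OF assms(2)])
  show "(basis_vec \<circ> b) x \<in> carrier (free_vs I undefined)" if "x \<in> U" for x
    using basis_vec_in funcset_mem[OF assms(3) that] by simp
  show "D n U (basis_vec \<circ> b)" if "admissible I G D" for D
    by (rule admissibleD(2)[where n = n and U = U and b = b, OF that assms(1)])
qed

section \<open>Universal property of the free diffeological vector space\<close>

lemma lin_ext_basis_vec:
  assumes "diff_vector_space W" "v i \<in> carrier W"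
  shows "lin_ext W v (basis_vec i) = v i"
  unfolding basis_vec_def by (rule diff_vector_space.lin_ext_basis[of W v i, OF assms])

text \<open>The pullback of the diffeology of \<open>W\<close> is admissible.\<close>

lemma smooth_linear_lin_ext:
  assumes W: "diff_vector_space W" and v: "v \<in> I \<rightarrow> carrier W"
    and gen: "\<And>n U b. G n U b \<Longrightarrow> b \<in> U \<rightarrow> I \<and> plot W n U (v \<circ> b)"
  shows "smooth_linear (free_dvs I G) W (lin_ext W v)"
proof -
  interpret W: diff_vector_space W by fact
  let ?h = "lin_ext W v"
  \<comment> \<open>\<open>initial_plot\<close> takes two maps; using \<open>?h\<close> for both
    gives the plain pullback along \<open>?h\<close>.\<close>
  define D where "D = initial_plot (free_vs I undefined) W ?h W ?h"
  have l: "linear_map (free_vs I E) W ?h" for E by (rule W.linear_lin_ext[OF v])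
  have D: "diff_vector_space (free_vs I D)"
    by (rule diff_vector_space_initial[OF module_free_vs W W l l])
       (simp add: D_def free_vs_simps fun_eq_iff initial_plot_def)
  have gen_D: "D n U (basis_vec \<circ> b)" if "G n U b" for n U b
  proof -
    have b: "b x \<in> I" if "x \<in> U" for x using gen[OF \<open>G n U b\<close>] that by auto
    have "plot W n U (?h \<circ> (basis_vec \<circ> b))"
    proof (rule W.plot_cong[OF conjunct2[OF gen[OF that]]])
      fix x assume "x \<in> U"
      then show "(v \<circ> b) x = (?h \<circ> (basis_vec \<circ> b)) x"
        using lin_ext_basis_vec[where v = v, OF W funcset_mem[OF v b]] by simp
    qed
    then show ?thesis
      unfolding D_def initial_plot_def using b basis_vec_in[of _ I] by auto
  qed
  have "D n U c" if "generated_plot I G n U c" for n U c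
    by (rule generated_plotD(3)[OF that]) (unfold admissible_def, intro conjI allI impI D gen_D)
  then have "plot W n U (?h \<circ> c)" if "generated_plot I G n U c" for n U c
    using that unfolding D_def initial_plot_def by simp
  moreover have "?h \<in> carrier (free_dvs I G) \<rightarrow> carrier W"
    unfolding free_dvs_def using linear_mapD(1)[OF l] by (rule funcsetI)
  ultimately have "smooth_map (carrier (free_dvs I G)) (plot (free_dvs I G)) (carrier W) (plot W) ?h"
    unfolding smooth_map_def by (simp add: free_dvs_def free_vs_simps(5))
  then show ?thesis using l unfolding smooth_linear_def free_dvs_def by simp
qed

text \<open>Together with \<open>linear_map_lin_ext\<close> this shows that a linear map on the free
  space is determined by its values on \<open>basis_vec\<close>.\<close>

lemma lin_ext_basis_vec_id:
  assumes c: "c \<in> carrier (free_dvs I G)"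
  shows "lin_ext (free_dvs I G) basis_vec c = c"
proof -
  interpret F: diff_vector_space "free_dvs I G" by (rule diff_vector_space_free_dvs)
  have e: "basis_vec i \<in> carrier (free_dvs I G)" if "i \<in> I" for i
    unfolding free_dvs_def by (rule basis_vec_in[OF that])
  \<comment> \<open>Partial sums of the expansion are truncations of \<open>c\<close>, a form that
    is stable under inserting an index.\<close>
  have "finite A \<Longrightarrow> A \<subseteq> I \<Longrightarrow> (\<Oplus>\<^bsub>free_dvs I G\<^esub>i\<in>A. c i \<odot>\<^bsub>free_dvs I G\<^esub> basis_vec i) =
      (\<lambda>j. if j \<in> A then c j else 0)" for A
  proof (induction A rule: finite_induct)
    case empty
    show ?case unfolding F.finsum_empty by (simp add: free_dvs_def free_vs_simps)
  next
    case (insert a A)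
    have "(\<Oplus>\<^bsub>free_dvs I G\<^esub>i\<in>insert a A. c i \<odot>\<^bsub>free_dvs I G\<^esub> basis_vec i) =
        c a \<odot>\<^bsub>free_dvs I G\<^esub> basis_vec a \<oplus>\<^bsub>free_dvs I G\<^esub> (\<lambda>j. if j \<in> A then c j else 0)"
      using insert e F.smult_in by (subst F.finsum_insert) auto
    also have "\<dots> = (\<lambda>j. if j \<in> insert a A then c j else 0)"
      using insert.hyps by (auto simp: free_dvs_def free_vs_simps basis_vec_def)
    finally show ?case .
  qed
  from this[of "supp c"] show ?thesis
    using c unfolding lin_ext_def by (auto simp: free_dvs_def free_vs_simps supp_def)
qed

section \<open>Enough projectives\<close>

text \<open>
  A family \<open>S\<close> of parametrizations gives the disjoint union of their domains, with the
  inclusions of the domains as generating parametrizations.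
\<close>

definition domain_points ::
    "(nat \<times> point set \<times> (point \<Rightarrow> 'a)) set \<Rightarrow> ((nat \<times> point set \<times> (point \<Rightarrow> 'a)) \<times> point) set" where
  "domain_points S = {((n, U, p), u). (n, U, p) \<in> S \<and> u \<in> U}"

definition domain_inclusion ::
    "(nat \<times> point set \<times> (point \<Rightarrow> 'a)) set \<Rightarrow> ((nat \<times> point set \<times> (point \<Rightarrow> 'a)) \<times> point) diffeology" where
  "domain_inclusion S n U b \<longleftrightarrow> (\<exists>p. (n, U, p) \<in> S \<and> b = Pair (n, U, p))"

lemma domain_inclusion_generator:
  assumes "(n, U, p) \<in> S" "openin (Euclidean_space n) U"
  shows "plot (free_dvs (domain_points S) (domain_inclusion S)) n U (basis_vec \<circ> Pair (n, U, p))"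
  using assms by (intro free_dvs_generator) (auto simp: domain_inclusion_def domain_points_def)

text \<open>The domains are disjoint, so lifts chosen for different parametrizations satisfy no
  compatibility condition. Within one domain the chosen values must form a plot on all of
  \<open>U\<close>, which is where the global lift enters.\<close>

lemma projective_free_domains:
  fixes S :: "(nat \<times> point set \<times> (point \<Rightarrow> 'a)) set"
  assumes S: "\<And>n U p. (n, U, p) \<in> S \<Longrightarrow> openin (Euclidean_space n) U"
  shows "projective (free_dvs (domain_points S) (domain_inclusion S))"
  unfolding projective_def
proof (intro conjI allI impI diff_vector_space_free_dvs)
  let ?I = "domain_points S" and ?G = "domain_inclusion S"
  let ?P = "free_dvs ?I ?G"
  fix W1 W2 :: "'a formal formal dvs" and f g
  assume W1: "diff_vector_space W1" and W2: "diff_vector_space W2"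
    and f: "linear_subduction W1 W2 f" and g: "smooth_linear ?P W2 g"
  interpret W1: diff_vector_space W1 by fact
  interpret W2: diff_vector_space W2 by fact
  have fl: "linear_map W1 W2 f" and gl: "linear_map ?P W2 g"
    using f g unfolding linear_subduction_def smooth_linear_def by auto
  have "\<exists>q. plot W1 n U q \<and> (\<forall>u\<in>U. f (q u) = g (basis_vec ((n, U, p), u)))"
    if "(n, U, p) \<in> S" for n U p
  proof -
    have "plot W2 n U (g \<circ> (basis_vec \<circ> Pair (n, U, p)))"
      using g domain_inclusion_generator[OF that S[OF that]]
      unfolding smooth_linear_def smooth_map_def by blast
    then show ?thesis using linear_subduction_lift[OF W1 W2 f] by fastforce
  qed
  then obtain q where q: "\<And>n U p. (n, U, p) \<in> S \<Longrightarrow> plot W1 n U (q n U p)"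
    "\<And>n U p u. (n, U, p) \<in> S \<Longrightarrow> u \<in> U \<Longrightarrow> f (q n U p u) = g (basis_vec ((n, U, p), u))"
    by metis
  define a where "a = (\<lambda>((n, U, p), u). q n U p u)"
  have aI: "a \<in> ?I \<rightarrow> carrier W1"
    unfolding a_def domain_points_def using W1.plot_in[OF q(1)] by auto
  have "smooth_linear ?P W1 (lin_ext W1 a)"
  proof (rule smooth_linear_lin_ext[OF W1 aI])
    fix n U b assume "?G n U b"
    then show "b \<in> U \<rightarrow> ?I \<and> plot W1 n U (a \<circ> b)"
      using q(1) by (auto simp: domain_inclusion_def domain_points_def a_def comp_def)
  qed
  moreover have "g c = f (lin_ext W1 a c)" if c: "c \<in> carrier ?P" for c
  proof -
    have cI: "supp c \<subseteq> ?I" using c by (simp add: free_dvs_def free_vs_simps)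
    have c': "c \<in> carrier (free_vs ?I undefined)"
      using c by (simp add: free_dvs_def free_vs_simps)
    have eI: "basis_vec \<in> ?I \<rightarrow> carrier ?P"
      unfolding free_dvs_def by (intro funcsetI basis_vec_in)
    have "g c = g (lin_ext ?P basis_vec c)" by (simp add: lin_ext_basis_vec_id[OF c])
    also have "\<dots> = lin_ext W2 (g \<circ> basis_vec) c"
      by (rule linear_map_lin_ext[OF diff_vector_space_free_dvs W2 gl eI c'])
    also have "\<dots> = lin_ext W2 (f \<circ> a) c"
      unfolding lin_ext_def
    proof (rule W2.finsum_cong')
      show "(\<lambda>i. c i \<odot>\<^bsub>W2\<^esub> (f \<circ> a) i) \<in> supp c \<rightarrow> carrier W2"
        using cI aI linear_mapD(1)[OF fl] W2.smult_in by (auto simp: Pi_iff subset_iff)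
      fix i assume "i \<in> supp c"
      then have "i \<in> ?I" using cI by blast
      then have "(g \<circ> basis_vec) i = (f \<circ> a) i"
        using q(2) by (auto simp: domain_points_def a_def)
      then show "c i \<odot>\<^bsub>W2\<^esub> (g \<circ> basis_vec) i = c i \<odot>\<^bsub>W2\<^esub> (f \<circ> a) i" by simp
    qed simp
    also have "\<dots> = f (lin_ext W1 a c)"
      by (rule linear_map_lin_ext[OF W1 W2 fl aI c', symmetric])
    finally show ?thesis .
  qed
  ultimately show "\<exists>h. smooth_linear ?P W1 h \<and> (\<forall>x\<in>carrier ?P. g x = f (h x))" by blast
qed

theorem theorem6p11:
  fixes V :: "'v dvs"
  assumes "diff_vector_space V"
  shows "\<exists>(P :: 'v formal dvs) \<pi>. projective P \<and> linear_subduction P V \<pi>"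
proof -
  interpret V: diff_vector_space V by fact
  \<comment> \<open>Total functions that agree on \<open>U\<close> count as different indices; this
    merely adds further copies of the same domain.\<close>
  define S where "S = {(n, U, p). plot V n U p}"
  have S: "(n, U, p) \<in> S \<longleftrightarrow> plot V n U p" for n U p by (simp add: S_def)
  let ?I = "domain_points S" and ?G = "domain_inclusion S"
  let ?P = "free_dvs ?I ?G"
  define v where "v = (\<lambda>((n :: nat, U :: point set, p :: point \<Rightarrow> 'v), u). p u)"
  define \<pi> where "\<pi> = lin_ext V v"
  have vI: "v \<in> ?I \<rightarrow> carrier V"
    using V.plot_in by (auto simp: v_def domain_points_def S)
  have \<pi>: "smooth_linear ?P V \<pi>"
    unfolding \<pi>_def
  proof (rule smooth_linear_lin_ext[OF assms vI])
    fix n U b assume "?G n U b"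
    then show "b \<in> U \<rightarrow> ?I \<and> plot V n U (v \<circ> b)"
      by (auto simp: domain_inclusion_def domain_points_def S v_def comp_def)
  qed
  have \<pi>e: "\<pi> (basis_vec ((n, U, p), u)) = p u" if "plot V n U p" "u \<in> U" for n U p u
    using lin_ext_basis_vec[OF assms, of v "((n, U, p), u)"] V.plot_in[OF that]
    by (simp add: \<pi>_def v_def)
  have lift: "plot ?P n U (basis_vec \<circ> Pair (n, U, p))" if "plot V n U p" for n U p
    using domain_inclusion_generator[of n U p S] V.plot_open[OF that] that by (simp add: S)
  have "linear_subduction ?P V \<pi>"
    unfolding linear_subduction_def
  proof (intro conjI \<pi> allI impI ballI)
    show "\<pi> ` carrier ?P = carrier V"
    proof
      show "\<pi> ` carrier ?P \<subseteq> carrier V"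
        using \<pi> unfolding smooth_linear_def linear_map_def by auto
      show "carrier V \<subseteq> \<pi> ` carrier ?P"
      proof
        fix x assume x: "x \<in> carrier V"
        \<comment> \<open>Surjectivity comes from the constant plots on the one-point space
          \<open>Euclidean_space 0\<close>.\<close>
        let ?U = "topspace (Euclidean_space 0)"
        have p: "plot V 0 ?U (\<lambda>_. x)" by (rule V.plot_const[OF _ x]) simp
        have u: "(\<lambda>_. 0) \<in> ?U" by (simp add: topspace_Euclidean_space)
        interpret P: diff_vector_space ?P by (rule diff_vector_space_free_dvs)
        show "x \<in> \<pi> ` carrier ?P"
          using \<pi>e[OF p u] P.plot_in[OF lift[OF p] u] by (auto intro!: rev_image_eqI)
      qed
    qed
  next
    fix n U p x assume p: "plot V n U p" and x: "x \<in> U"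
    \<comment> \<open>The lift is defined on the whole domain, so \<open>U\<close> itself serves as
      the neighbourhood.\<close>
    show "\<exists>U' q. openin (Euclidean_space n) U' \<and> x \<in> U' \<and> U' \<subseteq> U \<and>
                 plot ?P n U' q \<and> (\<forall>y\<in>U'. \<pi> (q y) = p y)"
      using V.plot_open[OF p] x lift[OF p] \<pi>e[OF p]
      by (intro exI[of _ U] exI[of _ "basis_vec \<circ> Pair (n, U, p)"]) auto
  qed
  moreover have "projective ?P"
    using V.plot_open by (intro projective_free_domains) (simp add: S)
  ultimately show ?thesis by blast
qed

end
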